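(* A diagram group can be simple, i.e. there exists a diagram group that is a simple group. In particular, there exist nontrivial diagram groups that coincide with their commutator subgroups, and so they do not admit an LOG-presentation.
   Context: An LOG-presentation is a group presentation in which every defining relation has the form $a=b^c$, where $a,b,c$ are generators and $b^c=c^{-1}bc$. Diagram groups. A semigroup presentation $\mathcal{P}=\langle\Sigma\mid\mathcal{R}\rangle$ consists of an alphabet $\Sigma$ and a set $\mathcal{R}$ of pairs $(u,v)$ of non-empty words over $\Sigma$, written $u=v$; presentations are assumed anti-symmetric: if $(u=v)\in\mathcal{R}$ then $(v=u)\notin\mathcal{R}$. $\Sigma^+$ and $\Sigma^*$ are the free semigroup and free monoid on $\Sigma$. The graph $\Gamma(\mathcal{P})$ has vertex set $\Sigma^+$ and an edge $(p,u\to v,q)$ from $puq$ to $pvq$ for all $p,q\in\Sigma^*$ and all $u,v$ with $(u=v)\in\mathcal{R}$ or $(v=u)\in\mathcal{R}$; the inverse edge is $(p,v\to u,q)$. The Squier complex $\mathcal{K}(\mathcal{P})$ is the 2-complex obtained from $\Gamma(\mathcal{P})$ by attaching, for all $p,z,q\in\Sigma^*$ and $(\ell_1=r_1),(\ell_2=r_2)\in\mathcal{R}$, a 2-cell along the closed path $p_1p_2^{-1}$, where $p_1=(p,\ell_1\to r_1,z\ell_2q)(pr_1z,\ell_2\to r_2,q)$ and $p_2=(p\ell_1z,\ell_2\to r_2,q)(p,\ell_1\to r_1,zr_2q)$. For $w\in\Sigma^+$ the diagram group $\mathcal{D}(\mathcal{P},w)$ is (up to isomorphism, by Kilibarda's theorem;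 this may be taken as the definition) the fundamental group $\pi_1(\mathcal{K}(\mathcal{P}),w)$. A group is a diagram group if it is isomorphic to some $\mathcal{D}(\mathcal{P},w)$. *)

theory Defs
  imports "HOL-Algebra.Generated_Groups"
begin

text \<open>
  Edges are oriented and come with a formal inverse. A 2-cell is recorded only through
  the closed edge path along which it is attached.
\<close>

record ('v, 'e) two_complex =
  verts :: "'v set"
  edges :: "'e set"
  init :: "'e \<Rightarrow> 'v"
  fin :: "'e \<Rightarrow> 'v"
  rev_edge :: "'e \<Rightarrow> 'e"
  cells :: "'e list set"

inductive edge_path :: "('v, 'e) two_complex \<Rightarrow> 'v \<Rightarrow> 'e list \<Rightarrow> 'v \<Rightarrow> bool"
  for K where
    edge_path_Nil: "x \<in> verts K \<Longrightarrow> edge_path K x [] x"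
  | edge_path_Cons: "e \<in> edges K \<Longrightarrow> edge_path K (fin K e) es y \<Longrightarrow> edge_path K (init K e) (e # es) y"

definition rev_path :: "('v, 'e) two_complex \<Rightarrow> 'e list \<Rightarrow> 'e list" where
  "rev_path K es = rev (map (rev_edge K) es)"

locale combinatorial_two_complex =
  fixes K :: "('v, 'e) two_complex"
  assumes init_in: "e \<in> edges K \<Longrightarrow> init K e \<in> verts K"
    and fin_in: "e \<in> edges K \<Longrightarrow> fin K e \<in> verts K"
    and rev_edge_in: "e \<in> edges K \<Longrightarrow> rev_edge K e \<in> edges K"
    and init_rev_edge: "e \<in> edges K \<Longrightarrow> init K (rev_edge K e) = fin K e"
    and rev_edge_rev_edge: "e \<in> edges K \<Longrightarrow> rev_edge K (rev_edge K e) = e"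
    and rev_edge_neq: "e \<in> edges K \<Longrightarrow> rev_edge K e \<noteq> e"
    and cell_closed: "c \<in> cells K \<Longrightarrow> \<exists>x. edge_path K x c x"

inductive homotopic_paths ::
    "('v, 'e) two_complex \<Rightarrow> 'v \<Rightarrow> 'v \<Rightarrow> 'e list \<Rightarrow> 'e list \<Rightarrow> bool"
  for K where
    htp_refl: "edge_path K x es y \<Longrightarrow> homotopic_paths K x y es es"
  | htp_sym: "homotopic_paths K x y es fs \<Longrightarrow> homotopic_paths K x y fs es"
  | htp_trans: "homotopic_paths K x y es fs \<Longrightarrow> homotopic_paths K x y fs gs
      \<Longrightarrow> homotopic_paths K x y es gs"
  | htp_append: "homotopic_paths K x y es es' \<Longrightarrow> homotopic_paths K y z fs fs'
      \<Longrightarrow> homotopic_paths K x z (es @ fs) (es' @ fs')"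
  | htp_cancel: "e \<in> edges K \<Longrightarrow> homotopic_paths K (init K e) (init K e) [e, rev_edge K e] []"
  | htp_cell: "c \<in> cells K \<Longrightarrow> edge_path K x c x \<Longrightarrow> homotopic_paths K x x c []"

definition homotopy_rel :: "('v, 'e) two_complex \<Rightarrow> 'v \<Rightarrow> ('e list \<times> 'e list) set" where
  "homotopy_rel K x = {(es, fs). homotopic_paths K x x es fs}"

definition fundamental_group :: "('v, 'e) two_complex \<Rightarrow> 'v \<Rightarrow> 'e list set monoid" where
  "fundamental_group K x =
     \<lparr> carrier = {es. edge_path K x es x} // homotopy_rel K x,
       mult = (\<lambda>A B. \<Union>es\<in>A. \<Union>fs\<in>B. homotopy_rel K x `` {es @ fs}),
       one = homotopy_rel K x `` {[]} \<rparr>"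

context combinatorial_two_complex
begin

lemma fin_rev_edge: "e \<in> edges K \<Longrightarrow> fin K (rev_edge K e) = init K e"
  using init_rev_edge[of "rev_edge K e"] rev_edge_in rev_edge_rev_edge by auto

lemma edge_path_ends: "edge_path K x es y \<Longrightarrow> x \<in> verts K \<and> y \<in> verts K"
  by (induction rule: edge_path.induct) (auto simp: init_in)

lemma edge_path_append: "edge_path K x es y \<Longrightarrow> edge_path K y fs z \<Longrightarrow> edge_path K x (es @ fs) z"
  by (induction rule: edge_path.induct) (auto intro: edge_path.intros)

lemma edge_path_rev_edge: "e \<in> edges K \<Longrightarrow> edge_path K (fin K e) [rev_edge K e] (init K e)"
  using edge_path_Cons[of "rev_edge K e" K "[]" "init K e"] edge_path_Nil[of "init K e" K]
  by (simp add: fin_rev_edge init_rev_edge rev_edge_in init_in)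

lemma edge_path_rev_path: "edge_path K x es y \<Longrightarrow> edge_path K y (rev_path K es) x"
  by (induction rule: edge_path.induct)
    (auto simp: rev_path_def intro: edge_path.intros edge_path_append edge_path_rev_edge)

lemma homotopic_paths_edge_path:
  "homotopic_paths K x y es fs \<Longrightarrow> edge_path K x es y \<and> edge_path K x fs y"
proof (induction rule: homotopic_paths.induct)
  case (htp_cancel e)
  have "edge_path K (init K e) (e # [rev_edge K e]) (init K e)"
    using htp_cancel by (intro edge_path_Cons edge_path_rev_edge)
  then show ?case using htp_cancel by (auto intro: edge_path_Nil init_in)
qed (auto intro: edge_path_append edge_path_Nil dest: edge_path_ends)

lemma homotopic_paths_rev_path:
  "edge_path K x es y \<Longrightarrow> homotopic_paths K x x (es @ rev_path K es) []"
proof (induction rule: edge_path.induct)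
  case (edge_path_Nil x)
  then show ?case by (auto simp: rev_path_def intro: htp_refl edge_path.edge_path_Nil)
next
  case (edge_path_Cons e es y)
  let ?i = "init K e" and ?f = "fin K e" and ?r = "[rev_edge K e]"
  have e: "edge_path K ?i [e] ?f"
    using edge_path_Cons by (auto intro!: edge_path.intros fin_in)
  have "homotopic_paths K ?i ?i ([e] @ ((es @ rev_path K es) @ ?r)) ([e] @ ([] @ ?r))"
    by (rule htp_append[OF htp_refl[OF e]
        htp_append[OF edge_path_Cons(3) htp_refl[OF edge_path_rev_edge[OF edge_path_Cons(1)]]]])
  then have "homotopic_paths K ?i ?i ([e] @ ((es @ rev_path K es) @ ?r)) []"
    using htp_cancel[OF edge_path_Cons(1)] by (auto intro: htp_trans)
  then show ?case by (simp add: rev_path_def)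
qed

lemma equiv_homotopy_rel: "equiv {es. edge_path K x es x} (homotopy_rel K x)"
  by (rule equivI)
    (auto simp: homotopy_rel_def refl_on_def sym_def trans_def
      dest: homotopic_paths_edge_path intro: htp_refl htp_sym htp_trans)

lemma fundamental_group_mult:
  assumes "edge_path K x es x" "edge_path K x fs x"
  shows "homotopy_rel K x `` {es} \<otimes>\<^bsub>fundamental_group K x\<^esub> homotopy_rel K x `` {fs}
    = homotopy_rel K x `` {es @ fs}"
proof -
  have "congruent2 (homotopy_rel K x) (homotopy_rel K x) (\<lambda>es fs. homotopy_rel K x `` {es @ fs})"
    unfolding congruent2_def
    by (auto simp: homotopy_rel_def intro: htp_append htp_trans htp_sym)
  from UN_equiv_class2[OF equiv_homotopy_rel equiv_homotopy_rel this, of es fs] assms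
  show ?thesis by (simp add: fundamental_group_def)
qed

theorem group_fundamental_group:
  assumes "x \<in> verts K"
  shows "group (fundamental_group K x)"
proof (rule groupI)
  let ?G = "fundamental_group K x" and ?c = "\<lambda>es. homotopy_rel K x `` {es}"
  have one: "\<one>\<^bsub>?G\<^esub> = ?c []" by (simp add: fundamental_group_def)
  have nil: "edge_path K x [] x" using assms by (rule edge_path_Nil)
  have car: "?c es \<in> carrier ?G" if "edge_path K x es x" for es
    using that by (auto simp: fundamental_group_def intro: quotientI)
  have carE: "\<exists>es. edge_path K x es x \<and> A = ?c es" if "A \<in> carrier ?G" for A
    using that by (auto simp: fundamental_group_def elim: quotientE)
  show "\<one>\<^bsub>?G\<^esub> \<in> carrier ?G" using car nil one by simp
  fix A assume "A \<in> carrier ?G"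
  then obtain a where a: "edge_path K x a x" "A = ?c a" using carE by blast
  show "\<one>\<^bsub>?G\<^esub> \<otimes>\<^bsub>?G\<^esub> A = A" by (simp add: one a fundamental_group_mult nil)
  have r: "edge_path K x (rev_path K a) x" using a edge_path_rev_path by blast
  have "rev_path K (rev_path K a) = a"
    using a(1) by (induction rule: edge_path.induct) (auto simp: rev_path_def rev_edge_rev_edge)
  then have "homotopic_paths K x x (rev_path K a @ a) []"
    using homotopic_paths_rev_path[OF r] by simp
  then have "?c (rev_path K a @ a) = ?c []"
    by (intro equiv_class_eq[OF equiv_homotopy_rel]) (simp add: homotopy_rel_def)
  then have "?c (rev_path K a) \<otimes>\<^bsub>?G\<^esub> A = \<one>\<^bsub>?G\<^esub>"
    by (simp add: one a r fundamental_group_mult)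
  then show "\<exists>B\<in>carrier ?G. B \<otimes>\<^bsub>?G\<^esub> A = \<one>\<^bsub>?G\<^esub>" using car r by blast
  fix B assume "B \<in> carrier ?G"
  then obtain b where b: "edge_path K x b x" "B = ?c b" using carE by blast
  show "A \<otimes>\<^bsub>?G\<^esub> B \<in> carrier ?G" 
    using a b by (simp add: fundamental_group_mult car[OF edge_path_append[OF a(1) b(1)]])
  fix C assume "C \<in> carrier ?G"
  then obtain c where c: "edge_path K x c x" "C = ?c c" using carE by blast
  show "A \<otimes>\<^bsub>?G\<^esub> B \<otimes>\<^bsub>?G\<^esub> C = A \<otimes>\<^bsub>?G\<^esub> (B \<otimes>\<^bsub>?G\<^esub> C)"
    using a b c edge_path_append by (simp add: fundamental_group_mult)
qed

end

record 's sgp =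
  alphabet :: "'s set"
  rels :: "('s list \<times> 's list) set"

definition semigroup_presentation :: "'s sgp \<Rightarrow> bool" where
  "semigroup_presentation P \<longleftrightarrow>
     (\<forall>(u, v) \<in> rels P. u \<in> lists (alphabet P) - {[]} \<and> v \<in> lists (alphabet P) - {[]}
        \<and> (v, u) \<notin> rels P)"

text \<open>The edge \<open>(p, u \<rightarrow> v, q)\<close> is the tuple \<open>(p, u, v, q)\<close>.\<close>

type_synonym 's squier_edge = "'s list \<times> 's list \<times> 's list \<times> 's list"

definition squier_edges :: "'s sgp \<Rightarrow> 's squier_edge set" where
  "squier_edges P = {(p, u, v, q). p \<in> lists (alphabet P) \<and> q \<in> lists (alphabet P)
     \<and> ((u, v) \<in> rels P \<or> (v, u) \<in> rels P)}"

definition squier_rev_edge :: "'s squier_edge \<Rightarrow> 's squier_edge" where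
  "squier_rev_edge = (\<lambda>(p, u, v, q). (p, v, u, q))"

text \<open>A 2-cell is attached along \<open>p\<^sub>1 p\<^sub>2\<inverse>\<close>, where \<open>p\<^sub>1\<close> and \<open>p\<^sub>2\<close> apply two disjoint rewritings in the two orders.\<close>

definition squier_cells :: "'s sgp \<Rightarrow> 's squier_edge list set" where
  "squier_cells P =
     {[(p, l1, r1, z @ l2 @ q), (p @ r1 @ z, l2, r2, q)]
        @ rev (map squier_rev_edge [(p @ l1 @ z, l2, r2, q), (p, l1, r1, z @ r2 @ q)])
      | p z q l1 r1 l2 r2.
        p \<in> lists (alphabet P) \<and> z \<in> lists (alphabet P) \<and> q \<in> lists (alphabet P)
        \<and> (l1, r1) \<in> rels P \<and> (l2, r2) \<in> rels P}"

definition squier_complex :: "'s sgp \<Rightarrow> ('s list, 's squier_edge) two_complex" where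
  "squier_complex P =
     \<lparr> verts = lists (alphabet P) - {[]},
       edges = squier_edges P,
       init = (\<lambda>(p, u, v, q). p @ u @ q),
       fin = (\<lambda>(p, u, v, q). p @ v @ q),
       rev_edge = squier_rev_edge,
       cells = squier_cells P \<rparr>"

lemma semigroup_presentationD:
  assumes "semigroup_presentation P" "(u, v) \<in> rels P"
  shows "x \<in> set u \<Longrightarrow> x \<in> alphabet P" "x \<in> set v \<Longrightarrow> x \<in> alphabet P"
    "u \<noteq> []" "v \<noteq> []" "(v, u) \<notin> rels P"
  using assms unfolding semigroup_presentation_def by blast+

lemma combinatorial_two_complex_squier:
  assumes "semigroup_presentation P"
  shows "combinatorial_two_complex (squier_complex P)"
proof
  let ?K = "squier_complex P"
  fix c assume "c \<in> cells ?K"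
  then obtain p z q l1 r1 l2 r2 where pq: "p \<in> lists (alphabet P)" "z \<in> lists (alphabet P)"
      "q \<in> lists (alphabet P)" "(l1, r1) \<in> rels P" "(l2, r2) \<in> rels P"
    and c: "c = [(p, l1, r1, z @ l2 @ q), (p @ r1 @ z, l2, r2, q),
      (p, r1, l1, z @ r2 @ q), (p @ l1 @ z, r2, l2, q)]"
    unfolding squier_complex_def squier_cells_def squier_rev_edge_def by force
  have w: "l1 \<in> lists (alphabet P) - {[]}" "r1 \<in> lists (alphabet P)"
      "l2 \<in> lists (alphabet P)" "r2 \<in> lists (alphabet P)"
    using pq assms unfolding semigroup_presentation_def by blast+
  have cons: "edge_path ?K x ((p, u, v, q) # es) y"
    if "(p, u, v, q) \<in> squier_edges P" "edge_path ?K (p @ v @ q) es y" "x = p @ u @ q"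
    for x y p u v q es
    using that edge_path_Cons[of "(p, u, v, q)" ?K es y] by (simp add: squier_complex_def)
  have "edge_path ?K (p @ l1 @ z @ l2 @ q) c (p @ l1 @ z @ l2 @ q)"
    unfolding c using pq w
    by (intro cons)
      (auto simp: squier_edges_def intro!: edge_path_Nil, auto simp: squier_complex_def)
  then show "\<exists>x. edge_path ?K x c x" ..
qed (auto simp: squier_complex_def squier_edges_def squier_rev_edge_def
    dest: semigroup_presentationD[OF assms])

definition squier_diagram_group :: "'s sgp \<Rightarrow> 's list \<Rightarrow> 's squier_edge list set monoid" where
  "squier_diagram_group P w = fundamental_group (squier_complex P) w"

lemma group_squier_diagram_group:
  assumes "semigroup_presentation P" "w \<in> lists (alphabet P) - {[]}"
  shows "group (squier_diagram_group P w)"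
  unfolding squier_diagram_group_def
  by (rule combinatorial_two_complex.group_fundamental_group[OF combinatorial_two_complex_squier])
    (use assms in \<open>simp_all add: squier_complex_def\<close>)

text \<open>The type argument is the type in which the letters of the alphabet live.\<close>

definition is_diagram_group :: "'s itself \<Rightarrow> ('g, 'm) monoid_scheme \<Rightarrow> bool" where
  "is_diagram_group _ G \<longleftrightarrow> group G \<and>
     (\<exists>(P :: 's sgp) w. semigroup_presentation P \<and> w \<in> lists (alphabet P) - {[]}
        \<and> G \<cong> squier_diagram_group P w)"

text \<open>
  The locale \<open>simple_group\<close> of HOL-Algebra requires \<open>order G > 1\<close>, where \<open>order\<close> is a cardinality
  in \<open>nat\<close> that is \<open>0\<close> for infinite carriers. It therefore excludes all infinite groups, in
  particular all nontrivial diagram groups, which are torsion-free.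
\<close>

definition is_simple_group :: "('g, 'm) monoid_scheme \<Rightarrow> bool" where
  "is_simple_group G \<longleftrightarrow> group G \<and> carrier G \<noteq> {\<one>\<^bsub>G\<^esub>} \<and>
     (\<forall>N. N \<lhd> G \<longrightarrow> N = {\<one>\<^bsub>G\<^esub>} \<or> N = carrier G)"

definition is_perfect_group :: "('g, 'm) monoid_scheme \<Rightarrow> bool" where
  "is_perfect_group G \<longleftrightarrow> group G \<and> derived G (carrier G) = carrier G"

text \<open>
  A group word is a list of letters \<open>(x, s)\<close>, where \<open>(x, True)\<close> stands for the generator \<open>x\<close> and
  \<open>(x, False)\<close> for its inverse.
\<close>

definition group_words :: "'x set \<Rightarrow> ('x \<times> bool) list set" where
  "group_words X = lists (X \<times> UNIV)"

inductive pres_cong ::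
    "'x set \<Rightarrow> (('x \<times> bool) list \<times> ('x \<times> bool) list) set
       \<Rightarrow> ('x \<times> bool) list \<Rightarrow> ('x \<times> bool) list \<Rightarrow> bool"
  for X R where
    pres_refl: "u \<in> group_words X \<Longrightarrow> pres_cong X R u u"
  | pres_sym: "pres_cong X R u v \<Longrightarrow> pres_cong X R v u"
  | pres_trans: "pres_cong X R u v \<Longrightarrow> pres_cong X R v w \<Longrightarrow> pres_cong X R u w"
  | pres_append: "pres_cong X R u u' \<Longrightarrow> pres_cong X R v v' \<Longrightarrow> pres_cong X R (u @ v) (u' @ v')"
  | pres_cancel: "x \<in> X \<Longrightarrow> pres_cong X R [(x, s), (x, \<not> s)] []"
  | pres_rel: "(u, v) \<in> R \<Longrightarrow> u \<in> group_words X \<Longrightarrow> v \<in> group_words X \<Longrightarrow> pres_cong X R u v"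

definition pres_cong_rel ::
    "'x set \<Rightarrow> (('x \<times> bool) list \<times> ('x \<times> bool) list) set
       \<Rightarrow> (('x \<times> bool) list \<times> ('x \<times> bool) list) set" where
  "pres_cong_rel X R = {(u, v). pres_cong X R u v}"

definition presented_group ::
    "'x set \<Rightarrow> (('x \<times> bool) list \<times> ('x \<times> bool) list) set \<Rightarrow> ('x \<times> bool) list set monoid" where
  "presented_group X R =
     \<lparr> carrier = group_words X // pres_cong_rel X R,
       mult = (\<lambda>A B. \<Union>u\<in>A. \<Union>v\<in>B. pres_cong_rel X R `` {u @ v}),
       one = pres_cong_rel X R `` {[]} \<rparr>"

text \<open>Every defining relation is \<open>a = b\<^sup>c = c\<inverse> b c\<close> with generators \<open>a\<close>, \<open>b\<close>, \<open>c\<close>.\<close>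

definition LOG_presentation ::
    "'x set \<Rightarrow> (('x \<times> bool) list \<times> ('x \<times> bool) list) set \<Rightarrow> bool" where
  "LOG_presentation X R \<longleftrightarrow>
     (\<forall>(u, v) \<in> R. \<exists>a\<in>X. \<exists>b\<in>X. \<exists>c\<in>X. u = [(a, True)] \<and> v = [(c, False), (b, True), (c, True)])"

text \<open>The type argument is the type in which the generators live.\<close>

definition admits_LOG_presentation :: "'x itself \<Rightarrow> ('g, 'm) monoid_scheme \<Rightarrow> bool" where
  "admits_LOG_presentation _ G \<longleftrightarrow>
     (\<exists>(X :: 'x set) R. LOG_presentation X R \<and> G \<cong> presented_group X R)"

lemma pres_cong_words: "pres_cong X R u v \<Longrightarrow> u \<in> group_words X \<and> v \<in> group_words X"
  by (induction rule: pres_cong.induct) (auto simp: group_words_def)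

lemma equiv_pres_cong_rel: "equiv (group_words X) (pres_cong_rel X R)"
  by (rule equivI)
    (auto simp: pres_cong_rel_def refl_on_def sym_def trans_def
      dest: pres_cong_words intro: pres_refl pres_sym pres_trans)

lemma presented_group_mult:
  assumes "u \<in> group_words X" "v \<in> group_words X"
  shows "pres_cong_rel X R `` {u} \<otimes>\<^bsub>presented_group X R\<^esub> pres_cong_rel X R `` {v}
    = pres_cong_rel X R `` {u @ v}"
proof -
  have "congruent2 (pres_cong_rel X R) (pres_cong_rel X R) (\<lambda>u v. pres_cong_rel X R `` {u @ v})"
    unfolding congruent2_def
    by (auto simp: pres_cong_rel_def intro: pres_append pres_trans pres_sym)
  from UN_equiv_class2[OF equiv_pres_cong_rel equiv_pres_cong_rel this, of u v] assms
  show ?thesis by (simp add: presented_group_def)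
qed

theorem group_presented_group: "group (presented_group X R)"
proof (rule groupI)
  let ?G = "presented_group X R" and ?c = "\<lambda>u. pres_cong_rel X R `` {u}"
  have one: "\<one>\<^bsub>?G\<^esub> = ?c []" by (simp add: presented_group_def)
  have nil: "[] \<in> group_words X" by (simp add: group_words_def)
  have app: "u @ v \<in> group_words X" if "u \<in> group_words X" "v \<in> group_words X" for u v
    using that by (auto simp: group_words_def)
  have car: "?c u \<in> carrier ?G" if "u \<in> group_words X" for u
    using that by (auto simp: presented_group_def intro: quotientI)
  have carE: "\<exists>u. u \<in> group_words X \<and> A = ?c u" if "A \<in> carrier ?G" for A
    using that by (auto simp: presented_group_def elim: quotientE)
  have inv: "\<exists>v. v \<in> group_words X \<and> pres_cong X R (v @ u) []" if "u \<in> group_words X" for u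
    using that
  proof (induction u)
    case Nil
    then show ?case using nil by (auto intro: pres_refl exI[of _ "[]"])
  next
    case (Cons a u)
    obtain x s where a: "a = (x, s)" by force
    have x: "x \<in> X" and u: "u \<in> group_words X" using Cons.prems by (auto simp: a group_words_def)
    obtain v where v: "v \<in> group_words X" "pres_cong X R (v @ u) []" using Cons u by blast
    have "pres_cong X R (v @ ([(x, \<not> s), (x, \<not> \<not> s)] @ u)) (v @ ([] @ u))"
      by (intro pres_append pres_cancel pres_refl v u x)
    then have "pres_cong X R ((v @ [(x, \<not> s)]) @ a # u) []"
      using v(2) by (auto simp: a intro: pres_trans)
    moreover have "v @ [(x, \<not> s)] \<in> group_words X" using v x by (auto simp: group_words_def)
    ultimately show ?case by blast
  qed
  show "\<one>\<^bsub>?G\<^esub> \<in> carrier ?G" using car nil one by simp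
  fix A assume "A \<in> carrier ?G"
  then obtain a where a: "a \<in> group_words X" "A = ?c a" using carE by blast
  show "\<one>\<^bsub>?G\<^esub> \<otimes>\<^bsub>?G\<^esub> A = A" by (simp add: one a presented_group_mult nil)
  obtain a' where a': "a' \<in> group_words X" "pres_cong X R (a' @ a) []" using inv a by blast
  then have "?c (a' @ a) = ?c []"
    by (intro equiv_class_eq[OF equiv_pres_cong_rel]) (simp add: pres_cong_rel_def)
  then have "?c a' \<otimes>\<^bsub>?G\<^esub> A = \<one>\<^bsub>?G\<^esub>"
    by (simp add: one a a' presented_group_mult)
  then show "\<exists>B\<in>carrier ?G. B \<otimes>\<^bsub>?G\<^esub> A = \<one>\<^bsub>?G\<^esub>" using car a' by blast
  fix B assume "B \<in> carrier ?G"
  then obtain b where b: "b \<in> group_words X" "B = ?c b" using carE by blast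
  show "A \<otimes>\<^bsub>?G\<^esub> B \<in> carrier ?G" by (simp add: a b presented_group_mult car app)
  fix C assume "C \<in> carrier ?G"
  then obtain c where c: "c \<in> group_words X" "C = ?c c" using carE by blast
  show "A \<otimes>\<^bsub>?G\<^esub> B \<otimes>\<^bsub>?G\<^esub> C = A \<otimes>\<^bsub>?G\<^esub> (B \<otimes>\<^bsub>?G\<^esub> C)"
    using a b c app by (simp add: presented_group_mult)
qed

end

theory Submission
  imports Defs "HOL-Algebra.Elementary_Groups" Complex_Main
begin

text \<open>
  The simple diagram group constructed here is isomorphic to the derived subgroup of Thompson's group
  \<open>F\<close>; the proof works with its action on an interval. Rewrite a letter \<open>x\<close> by \<open>x = x x\<close>, and take further
  letters \<open>a\<^sub>i\<close>, \<open>b\<^sub>j\<close> with \<open>a\<^sub>i = a\<^sub>i\<^sub>+\<^sub>1 x\<close> and \<open>b\<^sub>j = x b\<^sub>j\<^sub>+\<^sub>1\<close>; the base point is the word \<open>a\<^sub>0 b\<^sub>0\<close>. Every letter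
  is rewritten into two letters, so forgetting the names of the letters turns a loop into a piecewise
  linear homeomorphism of \<open>[0, 2]\<close> with dyadic break points and with powers of 2 as slopes. The indices
  of \<open>a\<^sub>i\<close> and \<open>b\<^sub>j\<close> count the subdivisions at the two ends. They return to 0 along a loop, which makes the
  homeomorphism the identity near 0 and near 2.

  Four facts about this action by \<open>path_map\<close> give simplicity.

  \<^item> It is faithful (\<open>loops_faithful\<close>): the rewriting system is confluent, and the confluence is
    witnessed by 2-cells, so every loop is homotopic to a positive path followed by an inverse
    positive path; and a positive path is determined up to 2-cells by its map.

  \<^item> It moves any compact subinterval of \<open>(0, 2)\<close> into any other one (\<open>compress_into_interval\<close>), because
    subdividing the ends and then joining the middle turns the first into the interval of a single letter \<open>x\<close>,
    a fine subdivision finds such an interval inside the second, and all words with a marked letter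
    \<open>x\<close> are connected by rewriting on the two sides of that letter.

  \<^item> By the commutator argument of Higman (\<open>derived_subset_normal\<close>), these two facts put the derived
    subgroup into every nontrivial normal subgroup.

  \<^item> The group is perfect (\<open>simple_diagram_group_perfect\<close>). A homomorphism to an abelian group is
    extended to edges, where the 2-cells become relations between its values. These force the value
    of the edge that rewrites a letter \<open>x\<close> not to depend on the position of \<open>x\<close>, and then the value
    of a positive path is determined by its end.

  Perfect groups have no LOG-presentation unless they are trivial: in a relation \<open>a = c\<inverse> b c\<close> both sides
  have exponent sum 1, so the exponent sum is a homomorphism onto the integers as soon as there is a
  generator.
\<close>

section \<open>Loops as group elements\<close>

context combinatorial_two_complex
begin

abbreviation path_class :: "'v \<Rightarrow> 'e list \<Rightarrow> 'e list set" where
  "path_class x es \<equiv> homotopy_rel K x `` {es}"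

lemma rev_path_append: "rev_path K (es @ fs) = rev_path K fs @ rev_path K es"
  by (simp add: rev_path_def)

lemma rev_path_rev_path: "edge_path K x es y \<Longrightarrow> rev_path K (rev_path K es) = es"
  by (induction rule: edge_path.induct) (auto simp: rev_path_def rev_edge_rev_edge)

lemma homotopic_rev_path_append: "edge_path K x es y \<Longrightarrow> homotopic_paths K y y (rev_path K es @ es) []"
  using homotopic_paths_rev_path[OF edge_path_rev_path] rev_path_rev_path by metis

lemma homotopic_append_left:
  "edge_path K x es y \<Longrightarrow> homotopic_paths K y z fs fs' \<Longrightarrow> homotopic_paths K x z (es @ fs) (es @ fs')"
  by (intro htp_append htp_refl)

lemma homotopic_append_right:
  "homotopic_paths K x y es es' \<Longrightarrow> edge_path K y fs z \<Longrightarrow> homotopic_paths K x z (es @ fs) (es' @ fs)"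
  by (intro htp_append htp_refl)

lemma homotopic_cancel_right:
  assumes "homotopic_paths K x z (es @ gs) (fs @ gs)"
    "edge_path K x es y" "edge_path K x fs y" "edge_path K y gs z"
  shows "homotopic_paths K x y es fs"
proof -
  have c: "homotopic_paths K x y (hs @ gs @ rev_path K gs) hs" if "edge_path K x hs y" for hs
    using homotopic_append_left[OF that homotopic_paths_rev_path[OF assms(4)]] by simp
  have "homotopic_paths K x y ((es @ gs) @ rev_path K gs) ((fs @ gs) @ rev_path K gs)"
    by (rule homotopic_append_right[OF assms(1) edge_path_rev_path[OF assms(4)]])
  then show ?thesis using c[OF assms(2)] c[OF assms(3)] by (auto intro: htp_trans htp_sym)
qed

lemma path_class_eq_iff:
  assumes "edge_path K x es x"
  shows "path_class x es = path_class x fs \<longleftrightarrow> homotopic_paths K x x es fs"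
proof
  assume "path_class x es = path_class x fs"
  moreover have "es \<in> path_class x es"
    using equiv_class_self[OF equiv_homotopy_rel[of x], of es] assms by simp
  ultimately have "homotopic_paths K x x fs es"
    by (simp add: homotopy_rel_def)
  then show "homotopic_paths K x x es fs" by (rule htp_sym)
next
  assume "homotopic_paths K x x es fs"
  then show "path_class x es = path_class x fs"
    by (intro equiv_class_eq[OF equiv_homotopy_rel]) (simp add: homotopy_rel_def)
qed

lemma carrier_fundamental_group:
  "carrier (fundamental_group K x) = path_class x ` {es. edge_path K x es x}"
  by (auto simp: fundamental_group_def quotient_def)

lemma path_class_in_carrier [intro]:
  "edge_path K x es x \<Longrightarrow> path_class x es \<in> carrier (fundamental_group K x)"
  by (simp add: carrier_fundamental_group)

lemma one_fundamental_group: "\<one>\<^bsub>fundamental_group K x\<^esub> = path_class x []"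
  by (simp add: fundamental_group_def)

lemma inv_path_class:
  assumes "edge_path K x es x"
  shows "inv\<^bsub>fundamental_group K x\<^esub> (path_class x es) = path_class x (rev_path K es)"
proof -
  interpret G: group "fundamental_group K x"
    using group_fundamental_group edge_path_ends[OF assms] by blast
  have "path_class x (rev_path K es) \<otimes>\<^bsub>fundamental_group K x\<^esub> path_class x es = \<one>\<^bsub>fundamental_group K x\<^esub>"
    using fundamental_group_mult[OF edge_path_rev_path[OF assms] assms]
      homotopic_rev_path_append[OF assms] path_class_eq_iff[OF edge_path_append[OF edge_path_rev_path[OF assms] assms]]
    by (simp add: one_fundamental_group)
  then show ?thesis
    using assms edge_path_rev_path by (intro G.inv_equality) auto
qed

end

section \<open>Abelian quotients of a fundamental group\<close>

text \<open>
  A homomorphism from a fundamental group to an abelian group extends to all edge paths that start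
  at a vertex reachable from the base point: close a path up along chosen walks from the base point
  to its ends. Commutativity makes the value at a loop based at the base point independent
  of the chosen walk, so the extension agrees with the given homomorphism there.
\<close>

locale abelian_image =
  combinatorial_two_complex K + \<pi>: group_hom "fundamental_group K w" A \<pi> + A: comm_group A
  for K :: "('v, 'e) two_complex" and w and A :: "('c, 'd) monoid_scheme" (structure) and \<pi> +
  assumes base: "w \<in> verts K"
begin

definition walk :: "'v \<Rightarrow> 'e list" where
  "walk u = (SOME es. edge_path K w es u)"

definition reachable :: "'v \<Rightarrow> bool" where
  "reachable u \<longleftrightarrow> (\<exists>es. edge_path K w es u)"

definition val :: "'v \<Rightarrow> 'v \<Rightarrow> 'e list \<Rightarrow> 'c" where
  "val u v es = \<pi> (path_class w (walk u @ es @ rev_path K (walk v)))"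

lemma walk: "reachable u \<Longrightarrow> edge_path K w (walk u) u"
  unfolding reachable_def walk_def by (rule someI_ex)

lemma reachable_base: "reachable w"
  using edge_path_Nil[OF base] unfolding reachable_def by blast

lemma reachable_step: "reachable u \<Longrightarrow> edge_path K u es v \<Longrightarrow> reachable v"
  unfolding reachable_def using edge_path_append by blast

lemma closed_up:
  assumes "reachable u" "edge_path K u es v"
  shows "edge_path K w (walk u @ es @ rev_path K (walk v)) w"
  by (rule edge_path_append[OF walk[OF assms(1)]
      edge_path_append[OF assms(2) edge_path_rev_path[OF walk[OF reachable_step[OF assms]]]]])

lemma val_in_carrier:
  "reachable u \<Longrightarrow> edge_path K u es v \<Longrightarrow> val u v es \<in> carrier A"
  unfolding val_def by (intro \<pi>.hom_closed path_class_in_carrier closed_up)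

lemma val_homotopic:
  assumes "reachable u" "homotopic_paths K u v es fs"
  shows "val u v es = val u v fs"
proof -
  have es: "edge_path K u es v" using assms homotopic_paths_edge_path by blast
  have "homotopic_paths K w w (walk u @ es @ rev_path K (walk v)) (walk u @ fs @ rev_path K (walk v))"
    by (rule homotopic_append_left[OF walk[OF assms(1)] homotopic_append_right[OF assms(2)
        edge_path_rev_path[OF walk[OF reachable_step[OF assms(1) es]]]]])
  then have "path_class w (walk u @ es @ rev_path K (walk v)) = path_class w (walk u @ fs @ rev_path K (walk v))"
    using closed_up[OF assms(1) es] by (simp add: path_class_eq_iff)
  then show ?thesis by (simp add: val_def)
qed

lemma val_append:
  assumes "reachable u" "edge_path K u es v" "edge_path K v fs x"
  shows "val u x (es @ fs) = val u v es \<otimes> val v x fs"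
proof -
  let ?p = "walk u @ es @ rev_path K (walk v)" and ?q = "walk v @ fs @ rev_path K (walk x)"
  have v: "reachable v" using assms reachable_step by blast
  have p: "edge_path K w ?p w" and q: "edge_path K w ?q w"
    using closed_up assms v by blast+
  have ux: "edge_path K w (walk u @ es) v" "edge_path K v (fs @ rev_path K (walk x)) w"
    using edge_path_append[OF walk[OF assms(1)] assms(2)]
      edge_path_append[OF assms(3) edge_path_rev_path[OF walk[OF reachable_step[OF v assms(3)]]]] by auto
  have "homotopic_paths K w w ((walk u @ es) @ (rev_path K (walk v) @ walk v) @ (fs @ rev_path K (walk x)))
      ((walk u @ es) @ [] @ (fs @ rev_path K (walk x)))"
    by (rule homotopic_append_left[OF ux(1)
        homotopic_append_right[OF homotopic_rev_path_append[OF walk[OF v]] ux(2)]])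
  then have "path_class w (?p @ ?q) = path_class w (walk u @ (es @ fs) @ rev_path K (walk x))"
    using edge_path_append[OF p q] by (simp add: path_class_eq_iff)
  then show ?thesis
    unfolding val_def using \<pi>.hom_mult[OF path_class_in_carrier[OF p] path_class_in_carrier[OF q]]
    by (simp add: fundamental_group_mult[OF p q])
qed

lemma val_loop:
  assumes "edge_path K w es w"
  shows "val w w es = \<pi> (path_class w es)"
proof -
  have t: "edge_path K w (walk w) w" "edge_path K w (rev_path K (walk w)) w"
    using walk reachable_base edge_path_rev_path by blast+
  have "path_class w (walk w @ es @ rev_path K (walk w)) =
      path_class w (walk w) \<otimes>\<^bsub>fundamental_group K w\<^esub> (path_class w es
        \<otimes>\<^bsub>fundamental_group K w\<^esub> inv\<^bsub>fundamental_group K w\<^esub> path_class w (walk w))"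
    by (simp add: fundamental_group_mult inv_path_class t assms edge_path_append[OF assms t(2)])
  then show ?thesis
    unfolding val_def using t assms
    by (simp add: path_class_in_carrier A.m_lcomm[of "\<pi> (path_class w (walk w))"])
qed

end

section \<open>Presentations that split every letter in two\<close>

locale letter_splitting =
  fixes split :: "'s \<Rightarrow> 's \<times> 's"
begin

definition halves :: "'s \<Rightarrow> 's list" where
  "halves c = [fst (split c), snd (split c)]"

definition presentation :: "'s sgp" where
  "presentation = \<lparr>alphabet = UNIV, rels = {([c], halves c) |c. True}\<rparr>"

abbreviation SC :: "('s list, 's squier_edge) two_complex" where
  "SC \<equiv> squier_complex presentation"

lemma semigroup_presentation: "semigroup_presentation presentation"
  by (auto simp: semigroup_presentation_def presentation_def halves_def)

sublocale combinatorial_two_complex SC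
  by (rule combinatorial_two_complex_squier[OF semigroup_presentation])

lemma verts_SC: "w \<in> verts SC \<longleftrightarrow> w \<noteq> []"
  by (simp add: squier_complex_def presentation_def)

definition expand :: "'s list \<Rightarrow> nat \<Rightarrow> 's list" where
  "expand w m = take m w @ halves (w ! m) @ drop (Suc m) w"

definition expansion :: "'s list \<Rightarrow> nat \<Rightarrow> 's squier_edge" where
  "expansion w m = (take m w, [w ! m], halves (w ! m), drop (Suc m) w)"

fun expand_all :: "'s list \<Rightarrow> nat list \<Rightarrow> 's list" where
  "expand_all w [] = w"
| "expand_all w (m # ms) = expand_all (expand w m) ms"

fun expansions :: "'s list \<Rightarrow> nat list \<Rightarrow> 's squier_edge list" where
  "expansions w [] = []"
| "expansions w (m # ms) = expansion w m # expansions (expand w m) ms"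

fun admissible :: "'s list \<Rightarrow> nat list \<Rightarrow> bool" where
  "admissible w [] \<longleftrightarrow> w \<noteq> []"
| "admissible w (m # ms) \<longleftrightarrow> m < length w \<and> admissible (expand w m) ms"

lemma length_expand [simp]: "m < length w \<Longrightarrow> length (expand w m) = Suc (length w)"
  by (simp add: expand_def halves_def)

lemma expand_nonempty [simp]: "expand w m \<noteq> []"
  by (simp add: expand_def halves_def)

lemma length_expand_all: "admissible w ms \<Longrightarrow> length (expand_all w ms) = length w + length ms"
  by (induction ms arbitrary: w) auto

lemma expand_decomp:
  "length p = m \<Longrightarrow> expand (p @ c # q) m = p @ halves c @ q"
  "length p = m \<Longrightarrow> expansion (p @ c # q) m = (p, [c], halves c, q)"
  by (auto simp: expand_def expansion_def)

lemma admissible_nonempty: "admissible w ms \<Longrightarrow> w \<noteq> []"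
  by (cases ms) auto

lemma expand_all_append: "expand_all w (ms @ ns) = expand_all (expand_all w ms) ns"
  by (induction ms arbitrary: w) auto

lemma expansions_append: "expansions w (ms @ ns) = expansions w ms @ expansions (expand_all w ms) ns"
  by (induction ms arbitrary: w) auto

lemma admissible_append:
  "admissible w (ms @ ns) \<longleftrightarrow> admissible w ms \<and> admissible (expand_all w ms) ns"
  by (induction ms arbitrary: w) (auto dest: admissible_nonempty)

lemma edge_cases:
  assumes "e \<in> edges SC"
  obtains (expansion) p c q where "e = (p, [c], halves c, q)"
  | (contraction) p c q where "e = (p, halves c, [c], q)"
  using assms by (auto simp: squier_complex_def squier_edges_def presentation_def)

lemma squier_simps:
  "init SC (p, u, v, q) = p @ u @ q" "fin SC (p, u, v, q) = p @ v @ q"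
  "rev_edge SC (p, u, v, q) = (p, v, u, q)"
  "(p, [c], halves c, q) \<in> edges SC" "(p, halves c, [c], q) \<in> edges SC"
  by (auto simp: squier_complex_def squier_edges_def presentation_def squier_rev_edge_def)

lemma edge_path_expansion:
  assumes "m < length w"
  shows "edge_path SC w [expansion w m] (expand w m)"
proof -
  define p c q where "p = take m w" and "c = w ! m" and "q = drop (Suc m) w"
  have w: "w = p @ c # q" "length p = m"
    using assms id_take_nth_drop[OF assms] by (simp_all add: p_def c_def q_def)
  let ?e = "(p, [c], halves c, q)"
  have "edge_path SC (fin SC ?e) [] (fin SC ?e)"
    by (intro edge_path_Nil fin_in squier_simps)
  from edge_path_Cons[OF squier_simps(4) this] show ?thesis
    using w by (simp add: expand_decomp squier_simps)
qed

lemma edge_path_expansions: "admissible w ms \<Longrightarrow> edge_path SC w (expansions w ms) (expand_all w ms)"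
proof (induction ms arbitrary: w)
  case Nil
  then show ?case by (simp add: edge_path_Nil verts_SC)
next
  case (Cons m ms)
  then show ?case
    using edge_path_append[OF edge_path_expansion Cons.IH, of m w] by simp
qed

text \<open>
  Two letters at positions \<open>m < k\<close> can be expanded in either order; these are exactly the 2-cells.
  Expanding at \<open>m\<close> first moves the other letter one place to the right.
\<close>

lemma homotopic_swap:
  assumes "m < k" "k < length w"
  shows expand_swap: "expand (expand w m) (Suc k) = expand (expand w k) m"
    and "homotopic_paths SC w (expand (expand w k) m) (expansions w [m, Suc k]) (expansions w [k, m])"
proof -
  define p c z d q where "p = take m w" and "c = w ! m" and "z = take (k - Suc m) (drop (Suc m) w)"
    and "d = w ! k" and "q = drop (Suc k) w"
  have "w = p @ c # drop (Suc m) w"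
    unfolding p_def c_def using assms by (intro id_take_nth_drop) simp
  moreover have "drop (Suc m) w = z @ d # q"
    using id_take_nth_drop[of "k - Suc m" "drop (Suc m) w"] assms by (simp add: z_def d_def q_def)
  ultimately have w: "w = p @ c # z @ d # q" by simp
  have l: "length p = m" "length z = k - Suc m" using assms by (simp_all add: p_def z_def)
  have wm: "expand w m = (p @ halves c @ z) @ d # q"
    using w l expand_decomp(1)[of p m c "z @ d # q"] by simp
  have lm: "length (p @ halves c @ z) = Suc k" using assms l by (simp add: halves_def)
  have wk: "expand w k = p @ c # z @ halves d @ q"
    using w l assms expand_decomp(1)[of "p @ c # z" k d q] by simp
  note ends = expand_decomp(1)[OF lm, of d q] expand_decomp(1)[OF l(1), of c "z @ halves d @ q"]
  show swap: "expand (expand w m) (Suc k) = expand (expand w k) m"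
    unfolding wm wk ends by simp
  let ?e1 = "(p, [c], halves c, z @ d # q)" and ?e2 = "(p @ halves c @ z, [d], halves d, q)"
  let ?f1 = "(p @ c # z, [d], halves d, q)" and ?f2 = "(p, [c], halves c, z @ halves d @ q)"
  have "expansion w m = ?e1" "expansion w k = ?f1"
    using w l assms expand_decomp(2)[of p m c "z @ d # q"] expand_decomp(2)[of "p @ c # z" k d q]
    by simp_all
  then have e: "expansions w [m, Suc k] = [?e1, ?e2]" and f: "expansions w [k, m] = [?f1, ?f2]"
    using expand_decomp(2)[OF lm, of d q] expand_decomp(2)[OF l(1), of c "z @ halves d @ q"]
    by (simp_all add: wm wk)
  let ?y = "expand (expand w k) m"
  have pe: "edge_path SC w [?e1, ?e2] ?y"
    unfolding e[symmetric] swap[symmetric] using edge_path_expansions[of w "[m, Suc k]"] assms by simp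
  have pf: "edge_path SC w [?f1, ?f2] ?y"
    unfolding f[symmetric] using edge_path_expansions[of w "[k, m]"] assms by simp
  have "[?e1, ?e2] @ rev_path SC [?f1, ?f2] \<in> cells SC"
    unfolding squier_complex_def squier_cells_def rev_path_def presentation_def by fastforce
  then have "homotopic_paths SC w w ([?e1, ?e2] @ rev_path SC [?f1, ?f2]) []"
    using edge_path_append[OF pe edge_path_rev_path[OF pf]] by (rule htp_cell)
  then have "homotopic_paths SC w w ([?e1, ?e2] @ rev_path SC [?f1, ?f2]) ([?f1, ?f2] @ rev_path SC [?f1, ?f2])"
    using htp_sym[OF homotopic_paths_rev_path[OF pf]] by (rule htp_trans)
  from homotopic_cancel_right[OF this pe pf edge_path_rev_path[OF pf]]
  show "homotopic_paths SC w ?y (expansions w [m, Suc k]) (expansions w [k, m])"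
    by (simp only: e f)
qed

section \<open>Positive normal form of edge paths\<close>

text \<open>
  A swap in front of a further sequence of expansions. It is used both to move expansions past each
  other in the confluence argument and to bring leftmost positions to the front.
\<close>

lemma homotopic_swap_expansions:
  assumes "m < k" "k < length w" "admissible (expand (expand w k) m) ms"
  shows "homotopic_paths SC w (expand_all w (k # m # ms)) (expansions w (m # Suc k # ms))
    (expansions w (k # m # ms))"
  using homotopic_append_right[OF homotopic_swap(2)[OF assms(1,2)] edge_path_expansions[OF assms(3)]]
  by (simp add: expand_swap[OF assms(1,2)])

lemma homotopic_expansions_Cons:
  assumes "m < length w" "homotopic_paths SC (expand w m) y (expansions (expand w m) ms) (expansions (expand w m) ns)"
  shows "homotopic_paths SC w y (expansions w (m # ms)) (expansions w (m # ns))"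
  using homotopic_append_left[OF edge_path_expansion[OF assms(1)] assms(2)] by simp

text \<open>
  An expansion at \<open>m\<close> can be pushed through any sequence of expansions: at each step it is either met,
  and then disappears, or it is disjoint from the next expansion and is exchanged with it by a 2-cell.
\<close>

lemma confluence:
  assumes "admissible w ms" "m < length w"
  shows "\<exists>ms' ns. admissible w (m # ms') \<and> admissible w (ms @ ns)
    \<and> expand_all w (m # ms') = expand_all w (ms @ ns)
    \<and> homotopic_paths SC w (expand_all w (ms @ ns)) (expansions w (m # ms')) (expansions w (ms @ ns))"
  using assms
proof (induction ms arbitrary: w m)
  case Nil
  then have "admissible w [m]" by simp
  then show ?case
    using htp_refl[OF edge_path_expansions[of w "[m]"]] by - (rule exI[of _ "[]"], rule exI[of _ "[m]"], simp)
next
  case (Cons k ms)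
  note k = Cons.prems(1)[simplified]
  consider "m = k" | "m < k" | "k < m" by linarith
  then show ?case
  proof cases
    case 1
    then show ?thesis using Cons.prems htp_refl[OF edge_path_expansions[OF Cons.prems(1)]]
      by - (rule exI[of _ ms], rule exI[of _ "[]"], simp)
  next
    case 2
    then obtain ms' ns where IH: "admissible (expand w k) (m # ms')" "admissible (expand w k) (ms @ ns)"
        "expand_all (expand w k) (m # ms') = expand_all (expand w k) (ms @ ns)"
        "homotopic_paths SC (expand w k) (expand_all (expand w k) (ms @ ns))
          (expansions (expand w k) (m # ms')) (expansions (expand w k) (ms @ ns))"
      using Cons.IH[of "expand w k" m] k by auto
    have "homotopic_paths SC w (expand_all w (k # ms @ ns)) (expansions w (m # Suc k # ms')) (expansions w (k # m # ms'))"
      using homotopic_swap_expansions[OF 2, of w ms'] k IH by simp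
    moreover have "homotopic_paths SC w (expand_all w (k # ms @ ns)) (expansions w (k # m # ms')) (expansions w (k # ms @ ns))"
      using homotopic_expansions_Cons[of k w, OF _ IH(4)] k by simp
    ultimately have "homotopic_paths SC w (expand_all w (k # ms @ ns)) (expansions w (m # Suc k # ms')) (expansions w (k # ms @ ns))"
      by (rule htp_trans)
    then show ?thesis using k 2 IH Cons.prems expand_swap[OF 2, of w]
      by - (rule exI[of _ "Suc k # ms'"], rule exI[of _ ns], simp)
  next
    case 3
    then obtain ms' ns where IH: "admissible (expand w k) (Suc m # ms')" "admissible (expand w k) (ms @ ns)"
        "expand_all (expand w k) (Suc m # ms') = expand_all (expand w k) (ms @ ns)"
        "homotopic_paths SC (expand w k) (expand_all (expand w k) (ms @ ns))
          (expansions (expand w k) (Suc m # ms')) (expansions (expand w k) (ms @ ns))"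
      using Cons.IH[of "expand w k" "Suc m"] k Cons.prems(2) by auto
    have "homotopic_paths SC w (expand_all w (k # ms @ ns)) (expansions w (k # Suc m # ms')) (expansions w (m # k # ms'))"
      using homotopic_swap_expansions[OF 3 Cons.prems(2), of ms'] k IH expand_swap[OF 3 Cons.prems(2)] by simp
    moreover have "homotopic_paths SC w (expand_all w (k # ms @ ns)) (expansions w (k # Suc m # ms')) (expansions w (k # ms @ ns))"
      using homotopic_expansions_Cons[of k w, OF _ IH(4)] k by simp
    ultimately have "homotopic_paths SC w (expand_all w (k # ms @ ns)) (expansions w (m # k # ms')) (expansions w (k # ms @ ns))"
      by (rule htp_trans[OF htp_sym])
    then show ?thesis using k 3 IH Cons.prems expand_swap[OF 3 Cons.prems(2)]
      by - (rule exI[of _ "k # ms'"], rule exI[of _ ns], simp)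
  qed
qed

text \<open>
  Induction from the front of the path. A leading expansion is prepended to the positive part. A
  leading contraction undoes an expansion, and confluence pushes that expansion through the positive
  part, which produces at most one further expansion, to be absorbed by the negative part.
\<close>

theorem positive_negative_form:
  assumes "edge_path SC w es w'"
  shows "\<exists>ms ns. admissible w ms \<and> admissible w' ns \<and> expand_all w ms = expand_all w' ns
    \<and> homotopic_paths SC w w' es (expansions w ms @ rev_path SC (expansions w' ns))"
  using assms
proof (induction rule: edge_path.induct)
  case (edge_path_Nil x)
  then show ?case
    using htp_refl[OF edge_path.edge_path_Nil[OF edge_path_Nil]]
    by (intro exI[of _ "[]"]) (auto simp: rev_path_def verts_SC)
next
  case (edge_path_Cons e es y)
  from edge_path_Cons.IH obtain ms ns where IH: "admissible (fin SC e) ms" "admissible y ns"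
      "expand_all (fin SC e) ms = expand_all y ns"
      "homotopic_paths SC (fin SC e) y es (expansions (fin SC e) ms @ rev_path SC (expansions y ns))"
    by blast
  let ?r = "rev_path SC (expansions y ns)"
  have e: "edge_path SC (init SC e) [e] (fin SC e)"
    using edge_path_Cons.hyps(1) by (intro edge_path.intros fin_in)
  have es: "homotopic_paths SC (init SC e) y (e # es) (e # expansions (fin SC e) ms @ ?r)"
    using homotopic_append_left[OF e IH(4)] by simp
  show ?case
  proof (cases rule: edge_cases[OF edge_path_Cons.hyps(1)])
    case (1 p c q)
    then have "init SC e = p @ c # q" "expand (p @ c # q) (length p) = fin SC e"
        "expansion (p @ c # q) (length p) = e"
      by (simp_all add: squier_simps expand_decomp)
    then show ?thesis using es IH by - (rule exI[of _ "length p # ms"], rule exI[of _ ns], auto)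
  next
    case (2 p c q)
    let ?m = "length p"
    define v where "v = fin SC e"
    have v: "?m < length v" "expand v ?m = init SC e" and rev_e: "rev_edge SC e = expansion v ?m"
      using 2 by (simp_all add: v_def squier_simps expand_decomp)
    note IH = IH[folded v_def] and es = es[folded v_def]
    have r: "edge_path SC (expand_all v ms) ?r y"
      using edge_path_rev_path[OF edge_path_expansions[OF IH(2)]] by (simp add: IH(3))
    obtain ms' ns' where c: "admissible v (?m # ms')" "admissible v (ms @ ns')"
        "expand_all v (?m # ms') = expand_all v (ms @ ns')"
        "homotopic_paths SC v (expand_all v (ms @ ns')) (expansions v (?m # ms')) (expansions v (ms @ ns'))"
      using confluence[OF IH(1) v(1)] by blast
    let ?x = "expand_all v ms" and ?z = "expand_all v (ms @ ns')"
    let ?t = "expansions ?x ns'"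
    have t: "edge_path SC ?x ?t ?z" using c(2) by (simp add: admissible_append expand_all_append edge_path_expansions)
    have vx: "edge_path SC v (expansions v ms) ?x" by (rule edge_path_expansions[OF IH(1)])
    have ms': "edge_path SC (init SC e) (expansions (init SC e) ms') ?z"
      using edge_path_expansions[of "expand v ?m" ms'] c(1) by (simp add: v(2) c(3)[symmetric])
    have ev: "edge_path SC (init SC e) [e] v" using e v_def by simp
    \<comment> \<open>The contraction \<open>e\<close> cancels against the leading expansion.\<close>
    have "homotopic_paths SC (init SC e) ?z ([e] @ expansions v (?m # ms')) (expansions (init SC e) ms')"
    proof -
      have "homotopic_paths SC (init SC e) (init SC e) [e, rev_edge SC e] []"
        by (rule htp_cancel[OF edge_path_Cons.hyps(1)])
      from homotopic_append_right[OF this ms'] show ?thesis by (simp add: rev_e v(2))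
    qed
    then have "homotopic_paths SC (init SC e) ?z ([e] @ expansions v (ms @ ns')) (expansions (init SC e) ms')"
      by (rule htp_trans[OF homotopic_append_left[OF ev htp_sym[OF c(4)]]])
    from homotopic_append_right[OF this edge_path_append[OF edge_path_rev_path[OF t] r]]
    have main: "homotopic_paths SC (init SC e) y (([e] @ expansions v ms) @ (?t @ rev_path SC ?t) @ ?r)
        (expansions (init SC e) ms' @ rev_path SC ?t @ ?r)"
      by (simp add: expansions_append)
    have "homotopic_paths SC (init SC e) y (([e] @ expansions v ms) @ (?t @ rev_path SC ?t) @ ?r)
        (([e] @ expansions v ms) @ [] @ ?r)"
      by (rule homotopic_append_left[OF edge_path_append[OF ev vx]
            homotopic_append_right[OF homotopic_paths_rev_path[OF t] r]])
    from htp_trans[OF htp_trans[OF _ htp_sym[OF this]] main] es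
    have "homotopic_paths SC (init SC e) y (e # es) (expansions (init SC e) ms' @ rev_path SC ?t @ ?r)"
      by simp
    moreover have "rev_path SC ?t @ ?r = rev_path SC (expansions y (ns @ ns'))"
      by (simp add: IH(3) expansions_append rev_path_append)
    moreover have "admissible y (ns @ ns')" "expand_all y (ns @ ns') = expand_all (init SC e) ms'"
        "admissible (init SC e) ms'"
      using IH(2) c(1-3) by (auto simp: v(2) IH(3) admissible_append expand_all_append)
    ultimately show ?thesis by - (rule exI[of _ ms'], rule exI[of _ "ns @ ns'"], simp)
  qed
qed

text \<open>
  By swaps, an expansion at a leftmost position can be carried out first. This replaces the
  normal form for the elements of the positive monoid of Thompson's group.
\<close>

lemma leftmost_first:
  assumes "admissible w ms" "ms \<noteq> []"
  shows "\<exists>m ns. admissible w (m # ns) \<and> expand_all w (m # ns) = expand_all w ms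
    \<and> length (m # ns) = length ms \<and> (\<forall>k\<in>set ns. m \<le> k)
    \<and> homotopic_paths SC w (expand_all w ms) (expansions w ms) (expansions w (m # ns))"
  using assms
proof (induction ms arbitrary: w)
  case (Cons k ms)
  show ?case
  proof (cases "ms = []")
    case True
    then show ?thesis using Cons.prems htp_refl[OF edge_path_expansions[OF Cons.prems(1)]]
      by - (rule exI[of _ k], rule exI[of _ "[]"], simp)
  next
    case False
    have k: "k < length w" "admissible (expand w k) ms" using Cons.prems by auto
    obtain m ns where m: "admissible (expand w k) (m # ns)"
        "expand_all (expand w k) (m # ns) = expand_all (expand w k) ms"
        "length (m # ns) = length ms" "\<forall>i\<in>set ns. m \<le> i"
        "homotopic_paths SC (expand w k) (expand_all (expand w k) ms) (expansions (expand w k) ms)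
           (expansions (expand w k) (m # ns))"
      using Cons.IH[OF k(2) False] by blast
    have h: "homotopic_paths SC w (expand_all w (k # ms)) (expansions w (k # ms)) (expansions w (k # m # ns))"
      using homotopic_expansions_Cons[OF k(1) m(5)] by simp
    show ?thesis
    proof (cases "m < k")
      case True
      have "homotopic_paths SC w (expand_all w (k # ms)) (expansions w (k # m # ns)) (expansions w (m # Suc k # ns))"
        using htp_sym[OF homotopic_swap_expansions[OF True k(1), of ns]] m(1,2) by simp
      from htp_trans[OF h this] m k True show ?thesis
        by - (rule exI[of _ m], rule exI[of _ "Suc k # ns"], auto simp: expand_swap)
    next
      case False
      with h m k show ?thesis by - (rule exI[of _ k], rule exI[of _ "m # ns"], auto)
    qed
  qed
qed simp

end

section \<open>The action on the real line\<close>

text \<open>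
  Give the letter at position \<open>m\<close> of a word the interval \<open>[m, m + 1]\<close>. Splitting that letter stretches
  its interval to length 2 and moves everything to its right by 1, whatever the letter is.
\<close>

definition stretch :: "nat \<Rightarrow> real \<Rightarrow> real" where
  "stretch m t = (if t \<le> m then t else if t \<le> m + 1 then 2 * t - m else t + 1)"

definition shrink :: "nat \<Rightarrow> real \<Rightarrow> real" where
  "shrink m t = (if t \<le> m then t else if t \<le> m + 2 then (t + m) / 2 else t - 1)"

lemma shrink_stretch: "shrink m (stretch m t) = t"
  by (auto simp: stretch_def shrink_def)

lemma stretch_shrink: "stretch m (shrink m t) = t"
  by (auto simp: stretch_def shrink_def field_simps)

lemma stretch_less: "s < t \<Longrightarrow> stretch m s < stretch m t"
  by (auto simp: stretch_def)

lemma shrink_less: "s < t \<Longrightarrow> shrink m s < shrink m t"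
  by (auto simp: shrink_def)

lemma stretch_swap: "m < k \<Longrightarrow> stretch (Suc k) (stretch m t) = stretch m (stretch k t)"
  by (auto simp: stretch_def)

lemma stretch_below: "t \<le> real m \<Longrightarrow> stretch m t = t"
  by (simp add: stretch_def)

lemma stretch_above: "real m + 1 \<le> t \<Longrightarrow> stretch m t = t + 1"
  by (simp add: stretch_def)

lemma stretch_inside: "real m \<le> t \<Longrightarrow> t \<le> real m + 1 \<Longrightarrow> stretch m t = 2 * t - m"
  by (simp add: stretch_def)

lemma stretch_ge: "t \<le> stretch m t"
  by (auto simp: stretch_def)

fun edge_map :: "'s squier_edge \<Rightarrow> real \<Rightarrow> real" where
  "edge_map (p, u, v, q) = (if length u = 1 then stretch (length p) else shrink (length p))"

fun path_map :: "'s squier_edge list \<Rightarrow> real \<Rightarrow> real" where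
  "path_map [] = id"
| "path_map (e # es) = path_map es \<circ> edge_map e"

lemma path_map_append: "path_map (es @ fs) = path_map fs \<circ> path_map es"
  by (induction es) auto

lemma edge_map_less: "s < t \<Longrightarrow> edge_map e s < edge_map e t"
  by (cases e) (auto simp: stretch_less shrink_less)

lemma path_map_less: "s < t \<Longrightarrow> path_map es s < path_map es t"
  by (induction es arbitrary: s t) (auto simp: edge_map_less)

lemma path_map_less_iff: "path_map es s < path_map es t \<longleftrightarrow> s < t"
  by (metis path_map_less linorder_neqE_linordered_idom order_less_asym)

lemma path_map_le_iff: "path_map es s \<le> path_map es t \<longleftrightarrow> s \<le> t"
  by (meson path_map_less_iff linorder_not_less)

context letter_splitting
begin

lemma edge_map_rev:
  assumes "e \<in> edges SC"
  shows "edge_map (rev_edge SC e) (edge_map e t) = t"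
  using assms
  by (cases rule: edge_cases) (auto simp: squier_simps halves_def shrink_stretch stretch_shrink)

text \<open>
  A map that depends only on positions and on the lengths of the two sides is automatically compatible with
  the 2-cells; the content is \<open>stretch_swap\<close>.
\<close>

lemma path_map_homotopic:
  "homotopic_paths SC x y es fs \<Longrightarrow> path_map es = path_map fs"
proof (induction rule: homotopic_paths.induct)
  case (htp_cell c x)
  then obtain p z q a b where c: "c = [(p, [a], halves a, z @ [b] @ q), (p @ halves a @ z, [b], halves b, q),
      (p, halves a, [a], z @ halves b @ q), (p @ [a] @ z, halves b, [b], q)]"
    unfolding squier_complex_def squier_cells_def squier_rev_edge_def presentation_def by auto
  let ?m = "length p" and ?k = "Suc (length p + length z)"
  have "stretch (Suc ?k) (stretch ?m t) = stretch ?m (stretch ?k t)" for t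
    by (rule stretch_swap) simp
  then have "shrink ?k (shrink ?m (stretch (Suc ?k) (stretch ?m t))) = t" for t
    by (simp only: shrink_stretch)
  then show ?case unfolding c by (auto simp: halves_def)
qed (auto simp: path_map_append edge_map_rev)

lemma path_map_rev_path:
  assumes "edge_path SC x es y"
  shows "path_map (rev_path SC es) (path_map es t) = t" "path_map es (path_map (rev_path SC es) t) = t"
  using path_map_homotopic[OF homotopic_paths_rev_path[OF assms]]
    path_map_homotopic[OF homotopic_rev_path_append[OF assms]]
  by (auto simp: path_map_append fun_eq_iff)

lemma edge_map_expansion: "m < length w \<Longrightarrow> edge_map (expansion w m) = stretch m"
  by (simp add: expansion_def min_def)

lemma path_map_expansions_fix:
  assumes "admissible w ms" "\<forall>m\<in>set ms. t \<le> real m"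
  shows "path_map (expansions w ms) t = t"
  using assms by (induction ms arbitrary: w) (auto simp: edge_map_expansion stretch_def)

lemma path_map_expansions_ge: "admissible w ms \<Longrightarrow> t \<le> path_map (expansions w ms) t"
proof (induction ms arbitrary: w t)
  case (Cons m ms)
  then show ?case
    using order_trans[OF stretch_ge Cons.IH[of "expand w m" "stretch m t"]]
    by (simp add: edge_map_expansion)
qed simp

text \<open>
  The first position of a leftmost-first sequence of expansions can be read off from the map: it is
  the supremum of the points below which the map is the identity. So the map determines the
  sequence, up to the swaps made by bringing leftmost positions to the front.
\<close>

theorem positive_paths_faithful:
  assumes "admissible w ms" "admissible w ns" "length ms = length ns"
    "path_map (expansions w ms) = path_map (expansions w ns)"
  shows "expand_all w ms = expand_all w ns
    \<and> homotopic_paths SC w (expand_all w ms) (expansions w ms) (expansions w ns)"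
  using assms
proof (induction "length ms" arbitrary: w ms ns)
  case 0
  then show ?case using edge_path_expansions[of w "[]"] by (auto intro: htp_refl)
next
  case (Suc l)
  obtain m ms' where m: "admissible w (m # ms')" "expand_all w (m # ms') = expand_all w ms"
      "length (m # ms') = length ms" "\<forall>k\<in>set ms'. m \<le> k"
      "homotopic_paths SC w (expand_all w ms) (expansions w ms) (expansions w (m # ms'))"
    using leftmost_first[OF Suc.prems(1)] Suc.hyps(2) by (metis length_0_conv nat.distinct(1))
  obtain n ns' where n: "admissible w (n # ns')" "expand_all w (n # ns') = expand_all w ns"
      "length (n # ns') = length ns" "\<forall>k\<in>set ns'. n \<le> k"
      "homotopic_paths SC w (expand_all w ns) (expansions w ns) (expansions w (n # ns'))"
    using leftmost_first[OF Suc.prems(2)] Suc.hyps(2) Suc.prems(3) by (metis length_0_conv nat.distinct(1))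
  have eq: "path_map (expansions w (m # ms')) = path_map (expansions w (n # ns'))"
    using Suc.prems(4) path_map_homotopic[OF m(5)] path_map_homotopic[OF n(5)] by simp
  have not_less: "\<not> i < j" if "admissible w (i # is)" "admissible w (j # js)" "\<forall>k\<in>set js. j \<le> k"
      "path_map (expansions w (i # is)) = path_map (expansions w (j # js))" for i j "is" js
  proof
    assume "i < j"
    have "path_map (expansions w (j # js)) (real j) = real j"
      using that by (intro path_map_expansions_fix) auto
    moreover have "real j < stretch i (real j)" using \<open>i < j\<close> by (simp add: stretch_def)
    moreover have "stretch i (real j) \<le> path_map (expansions w (i # is)) (real j)"
      using path_map_expansions_ge[of "expand w i" "is"] that(1) by (simp add: edge_map_expansion)
    ultimately show False using that(4) by (simp del: expansions.simps)
  qed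
  have "m = n" using not_less[OF m(1) n(1,4) eq] not_less[OF n(1) m(1,4) eq[symmetric]] by simp
  have "path_map (expansions (expand w m) ms') t = path_map (expansions (expand w m) ns') t" for t
  proof -
    have "path_map (expansions w (m # ms')) (shrink m t) = path_map (expansions w (n # ns')) (shrink m t)"
      by (simp only: eq)
    then show ?thesis using m(1) \<open>m = n\<close> by (simp add: edge_map_expansion stretch_shrink)
  qed
  then have "expand_all (expand w m) ms' = expand_all (expand w m) ns'"
      "homotopic_paths SC (expand w m) (expand_all (expand w m) ms') (expansions (expand w m) ms') (expansions (expand w m) ns')"
    using Suc.hyps(1)[of ms' "expand w m" ns'] Suc.hyps(2) m n \<open>m = n\<close> Suc.prems(3) by auto
  then have ends: "expand_all w ms = expand_all w ns"
      and h: "homotopic_paths SC w (expand_all w ms) (expansions w (m # ms')) (expansions w (m # ns'))"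
    using m n \<open>m = n\<close> homotopic_expansions_Cons[of m w "expand_all w ms" ms' ns'] by auto
  have "homotopic_paths SC w (expand_all w ms) (expansions w (m # ns')) (expansions w ns)"
    using htp_sym[OF n(5)] ends \<open>m = n\<close> by simp
  from htp_trans[OF htp_trans[OF m(5) h] this] ends show ?case by simp
qed

text \<open>
  If a loop acts trivially, the two positive paths of its normal form act in the same way. They have the same
  number of expansions because they end in words of the same length, so they are homotopic.
\<close>

theorem loops_faithful:
  assumes "edge_path SC w es w" "path_map es = id"
  shows "homotopic_paths SC w w es []"
proof -
  obtain ms ns where f: "admissible w ms" "admissible w ns" "expand_all w ms = expand_all w ns"
      "homotopic_paths SC w w es (expansions w ms @ rev_path SC (expansions w ns))"
    using positive_negative_form[OF assms(1)] by blast
  have pn: "edge_path SC w (expansions w ns) (expand_all w ns)"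
    by (rule edge_path_expansions[OF f(2)])
  have "length ms = length ns"
    using length_expand_all[OF f(1)] length_expand_all[OF f(2)] f(3) by simp
  moreover have "path_map (expansions w ms) t = path_map (expansions w ns) t" for t
  proof -
    have "path_map (rev_path SC (expansions w ns)) (path_map (expansions w ms) t) = t"
      using path_map_homotopic[OF f(4)] assms(2) by (simp add: path_map_append fun_eq_iff)
    then show ?thesis using path_map_rev_path(2)[OF pn] by metis
  qed
  ultimately have "homotopic_paths SC w (expand_all w ns) (expansions w ms) (expansions w ns)"
    using positive_paths_faithful[OF f(1,2)] f(3) by auto
  from htp_trans[OF f(4) htp_trans[OF homotopic_append_right[OF this edge_path_rev_path[OF pn]]
        homotopic_paths_rev_path[OF pn]]]
  show ?thesis .
qed

end

section \<open>Simplicity of the derived subgroup\<close>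

lemma (in normal) commutator_closed:
  assumes "x \<in> H" "g \<in> carrier G"
  shows "g \<otimes> x \<otimes> inv g \<otimes> inv x \<in> H" "x \<otimes> g \<otimes> inv x \<otimes> inv g \<in> H"
  using subgroup.m_closed[OF is_subgroup inv_op_closed2[OF assms(2,1)] m_inv_closed[OF assms(1)]]
    subgroup.m_closed[OF is_subgroup assms(1) inv_op_closed2[OF assms(2) m_inv_closed[OF assms(1)]]] assms mem_carrier
  by (simp_all add: m_assoc)

text \<open>
  Higman's argument. Given \<open>a\<close> and \<open>b\<close>, conjugate a nontrivial element of \<open>N\<close> to an element \<open>d\<close> that moves
  the union of the supports of \<open>a\<close> and \<open>b\<close> off itself. Then \<open>a\<close> times the inverse of its conjugate by \<open>d\<close>
  lies in \<open>N\<close>, and the second factor has support disjoint from that of \<open>b\<close>, so that it is invisible in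
  the commutator with \<open>b\<close>. The action is written on the right: \<open>g \<otimes> h\<close> acts by \<open>g\<close> first.
\<close>

theorem (in group) derived_subset_normal:
  fixes act :: "'a \<Rightarrow> 'p \<Rightarrow> 'p"
  assumes act_one: "act \<one> = id"
    and act_mult: "\<And>g h. g \<in> carrier G \<Longrightarrow> h \<in> carrier G \<Longrightarrow> act (g \<otimes> h) = act h \<circ> act g"
    and faithful: "\<And>g. g \<in> carrier G \<Longrightarrow> act g = id \<Longrightarrow> g = \<one>"
    and displace: "\<And>a b c. \<lbrakk>a \<in> carrier G; b \<in> carrier G; c \<in> carrier G; c \<noteq> \<one>\<rbrakk> \<Longrightarrow>
      \<exists>h\<in>carrier G. \<forall>s\<in>{t. act a t \<noteq> t \<or> act b t \<noteq> t}. \<forall>t\<in>{t. act a t \<noteq> t \<or> act b t \<noteq> t}.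
        act c (act h s) \<noteq> act h t"
    and N: "N \<lhd> G" "N \<noteq> {\<one>}"
  shows "derived G (carrier G) \<subseteq> N"
proof -
  interpret N: normal N G by (rule N(1))
  have inv_act: "act (inv g) (act g t) = t" "act g (act (inv g) t) = t" if "g \<in> carrier G" for g t
    using that act_mult[of g "inv g"] act_mult[of "inv g" g] act_one by (auto simp: fun_eq_iff)
  have act_inj: "act g s = act g t \<longleftrightarrow> s = t" if "g \<in> carrier G" for g s t
    by (metis inv_act(1) that)
  have act_eqD: "g = h" if "g \<in> carrier G" "h \<in> carrier G" "\<And>t. act g t = act h t" for g h
  proof -
    have "act (g \<otimes> inv h) = id" using that by (auto simp: act_mult inv_act fun_eq_iff)
    then have "g \<otimes> inv h = \<one>" using that by (intro faithful) auto
    then show ?thesis using that by (metis inv_closed inv_equality inv_inv)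
  qed
  have comm: "x \<otimes> y = y \<otimes> x"
    if xy: "x \<in> carrier G" "y \<in> carrier G" and disj: "\<And>t. act x t = t \<or> act y t = t" for x y
  proof (rule act_eqD)
    fix t
    have "act y (act x t) = act x (act y t)"
      using disj[of t] disj[of "act x t"] disj[of "act y t"] act_inj[OF xy(1)] act_inj[OF xy(2)]
      by metis
    then show "act (x \<otimes> y) t = act (y \<otimes> x) t" using xy by (simp add: act_mult)
  qed (use xy in auto)
  obtain c where c: "c \<in> N" "c \<noteq> \<one>" using N N.one_closed by blast
  have "a \<otimes> b \<otimes> inv a \<otimes> inv b \<in> N" if a: "a \<in> carrier G" and b: "b \<in> carrier G" for a b
  proof -
    have cG: "c \<in> carrier G" using c N.mem_carrier by simp
    let ?K = "{t. act a t \<noteq> t \<or> act b t \<noteq> t}"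
    obtain h where h: "h \<in> carrier G" "\<And>s t. s \<in> ?K \<Longrightarrow> t \<in> ?K \<Longrightarrow> act c (act h s) \<noteq> act h t"
      using displace[OF a b cG c(2)] by meson
    define d where "d = h \<otimes> c \<otimes> inv h"
    have d: "d \<in> N" using N.inv_op_closed2[OF h(1) c(1)] by (simp add: d_def)
    then have dG: "d \<in> carrier G" by (rule N.mem_carrier)
    have disj: "act d t \<notin> ?K" if "t \<in> ?K" for t
    proof
      assume "act d t \<in> ?K"
      then have "act c (act h t) \<noteq> act h (act d t)" using h that by blast
      then show False using h(1) cG by (simp add: d_def act_mult inv_act)
    qed
    define e where "e = inv d \<otimes> inv a \<otimes> d"
    have e: "e \<in> carrier G" using a dG by (simp add: e_def)
    have supp_e: "act e t = t" if "act (inv d) t \<notin> ?K" for t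
    proof -
      let ?s = "act (inv d) t"
      have "act a ?s = ?s" using that by simp
      then have "act (inv a) ?s = ?s" using inv_act(1)[OF a, of ?s] by simp
      then show ?thesis using a dG by (simp add: e_def act_mult inv_act)
    qed
    have "e \<otimes> b = b \<otimes> e"
    proof (rule comm[OF e b])
      fix t show "act e t = t \<or> act b t = t"
        using supp_e[of t] disj[of "act (inv d) t"] inv_act(2)[OF dG, of t] by auto
    qed
    \<comment> \<open>Replacing \<open>a\<close> by \<open>a \<otimes> e = [a, d\<inverse>]\<close>, which lies in \<open>N\<close>, does not change its commutator with \<open>b\<close>.\<close>
    have "a \<otimes> e \<in> N"
      using N.commutator_closed(1)[of "inv d" a] N.m_inv_closed d a dG by (simp add: e_def m_assoc)
    then have "(a \<otimes> e) \<otimes> b \<otimes> inv (a \<otimes> e) \<otimes> inv b \<in> N"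
      by (rule N.commutator_closed(2)[OF _ b])
    moreover have "(a \<otimes> e) \<otimes> b \<otimes> inv (a \<otimes> e) \<otimes> inv b = a \<otimes> (e \<otimes> b \<otimes> inv e) \<otimes> inv a \<otimes> inv b"
      using a b e by (simp add: m_assoc inv_mult_group)
    moreover have "e \<otimes> b \<otimes> inv e = b"
      using \<open>e \<otimes> b = b \<otimes> e\<close> b e by (simp add: m_assoc)
    ultimately show ?thesis by simp
  qed
  then have "derived_set G (carrier G) \<subseteq> N" by auto
  then show ?thesis
    unfolding derived_def by (intro generate_subgroup_incl N.is_subgroup)
qed

section \<open>Perfect groups and LOG-presentations\<close>

lemma (in group) derived_eq_carrierI:
  assumes "\<And>x. x \<in> carrier G \<Longrightarrow> derived G (carrier G) #> x = derived G (carrier G)"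
  shows "derived G (carrier G) = carrier G"
proof
  show "derived G (carrier G) \<subseteq> carrier G" by (rule derived_in_carrier) simp
  show "carrier G \<subseteq> derived G (carrier G)"
    using assms rcos_self[OF _ derived_is_subgroup[OF subset_refl]] by blast
qed

lemma perfect_group_hom_trivial:
  assumes "is_perfect_group G" "comm_group A" "f \<in> hom G A" "x \<in> carrier G"
  shows "f x = \<one>\<^bsub>A\<^esub>"
proof -
  have G: "group G" "derived G (carrier G) = carrier G" using assms(1) by (auto simp: is_perfect_group_def)
  interpret f: group_hom G A f
    using assms G by (simp add: group_hom_def group_hom_axioms_def comm_group.axioms(2))
  have "f x \<in> f ` derived G (carrier G)" using assms(4) G by blast
  also have "\<dots> = derived A (f ` carrier G)" by (rule f.derived_img[symmetric]) simp
  also have "\<dots> = {\<one>\<^bsub>A\<^esub>}" by (rule comm_group.derived_eq_singleton[OF assms(2)]) auto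
  finally show ?thesis by simp
qed

definition exponent_sum :: "('x \<times> bool) list \<Rightarrow> int" where
  "exponent_sum u = (\<Sum>(x, s)\<leftarrow>u. if s then 1 else - 1)"

lemma exponent_sum_append: "exponent_sum (u @ v) = exponent_sum u + exponent_sum v"
  by (simp add: exponent_sum_def)

text \<open>Both sides of a relation \<open>a = c\<inverse> b c\<close> have exponent sum 1, so the exponent sum of group elements is well defined.\<close>

lemma exponent_sum_pres_cong:
  assumes "LOG_presentation X R" "pres_cong X R u v"
  shows "exponent_sum u = exponent_sum v"
  using assms(2)
proof (induction rule: pres_cong.induct)
  case (pres_rel u v)
  then have "\<exists>a b c. u = [(a, True)] \<and> v = [(c, False), (b, True), (c, True)]"
    using assms(1) unfolding LOG_presentation_def by blast
  then show ?case by (auto simp: exponent_sum_def)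
qed (auto simp: exponent_sum_append, auto simp: exponent_sum_def)

definition exponent_hom :: "('x \<times> bool) list set \<Rightarrow> int" where
  "exponent_hom A = exponent_sum (SOME u. u \<in> A)"

lemma exponent_hom_class:
  assumes "LOG_presentation X R" "u \<in> group_words X"
  shows "exponent_hom (pres_cong_rel X R `` {u}) = exponent_sum u"
proof -
  have "u \<in> pres_cong_rel X R `` {u}"
    using equiv_class_self[OF equiv_pres_cong_rel assms(2)] .
  then have "(SOME v. v \<in> pres_cong_rel X R `` {u}) \<in> pres_cong_rel X R `` {u}" by (rule someI)
  then show ?thesis
    using exponent_sum_pres_cong[OF assms(1)] by (simp add: exponent_hom_def pres_cong_rel_def)
qed

lemma exponent_hom:
  assumes "LOG_presentation X R"
  shows "exponent_hom \<in> hom (presented_group X R) integer_group"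
proof (rule homI)
  fix A B assume "A \<in> carrier (presented_group X R)" "B \<in> carrier (presented_group X R)"
  then obtain u v where uv: "u \<in> group_words X" "v \<in> group_words X"
      "A = pres_cong_rel X R `` {u}" "B = pres_cong_rel X R `` {v}"
    by (auto simp: presented_group_def quotient_def)
  then have "u @ v \<in> group_words X" by (auto simp: group_words_def)
  with uv show "exponent_hom (A \<otimes>\<^bsub>presented_group X R\<^esub> B) = exponent_hom A \<otimes>\<^bsub>integer_group\<^esub> exponent_hom B"
    by (simp add: presented_group_mult exponent_hom_class[OF assms] exponent_sum_append)
qed simp

theorem perfect_group_no_LOG_presentation:
  fixes G :: "('g, 'm) monoid_scheme"
  assumes G: "is_perfect_group G" "carrier G \<noteq> {\<one>\<^bsub>G\<^esub>}"
  shows "\<not> admits_LOG_presentation TYPE('x) G"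
proof
  assume "admits_LOG_presentation TYPE('x) G"
  then obtain X :: "'x set" and R f where LOG: "LOG_presentation X R"
      and f: "f \<in> iso G (presented_group X R)"
    by (auto simp: admits_LOG_presentation_def is_iso_def)
  have grp: "group G" using G by (simp add: is_perfect_group_def)
  have bij: "bij_betw f (carrier G) (carrier (presented_group X R))" and hom: "f \<in> hom G (presented_group X R)"
    using f by (auto simp: iso_def)
  show False
  proof (cases "X = {}")
    case True
    then have "carrier (presented_group X R) = {\<one>\<^bsub>presented_group X R\<^esub>}"
      by (auto simp: presented_group_def group_words_def quotient_def)
    then have "card (carrier G) = 1" using bij_betw_same_card[OF bij] by simp
    then obtain g where "carrier G = {g}" by (auto simp: card_1_singleton_iff)
    then show False using G(2) group.is_monoid[OF grp] monoid.one_closed by fastforce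
  next
    case False
    then obtain x where "x \<in> X" by blast
    then have x: "[(x, True)] \<in> group_words X" by (simp add: group_words_def)
    then have "pres_cong_rel X R `` {[(x, True)]} \<in> carrier (presented_group X R)"
      by (auto simp: presented_group_def intro: quotientI)
    then obtain g where g: "g \<in> carrier G" "f g = pres_cong_rel X R `` {[(x, True)]}"
      using bij by (metis bij_betw_def imageE)
    have "exponent_hom \<circ> f \<in> hom G integer_group"
      using hom exponent_hom[OF LOG] by (rule hom_compose)
    then have "exponent_hom (f g) = 0"
      using perfect_group_hom_trivial[OF G(1) abelian_integer_group _ g(1)] by fastforce
    then show False using exponent_hom_class[OF LOG x] g(2) by (simp add: exponent_sum_def)
  qed
qed

section \<open>The presentation\<close>

text \<open>
  The letter \<open>0\<close> is \<open>x\<close>, the odd letter \<open>2 * i + 1\<close> is \<open>a\<^sub>i\<close>, and the even letter \<open>2 * j + 2\<close> is \<open>b\<^sub>j\<close>. All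
  words that are connected with \<open>a\<^sub>0 b\<^sub>0\<close> have the form \<open>a\<^sub>i x\<^sup>k b\<^sub>j\<close>.
\<close>

definition end_split :: "nat \<Rightarrow> nat \<times> nat" where
  "end_split c = (if c = 0 then (0, 0) else if odd c then (c + 2, 0) else (0, c + 2))"

interpretation F: letter_splitting end_split .

definition word :: "nat \<Rightarrow> nat \<Rightarrow> nat \<Rightarrow> nat list" where
  "word i k j = (2 * i + 1) # replicate k 0 @ [2 * j + 2]"

lemma length_word [simp]: "length (word i k j) = k + 2"
  by (simp add: word_def)

lemma word_nonempty [simp]: "word i k j \<noteq> []"
  by (simp add: word_def)

lemma word_eq_iff [simp]: "word i k j = word i' k' j' \<longleftrightarrow> i = i' \<and> k = k' \<and> j = j'"
proof
  assume eq: "word i k j = word i' k' j'"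
  then have "k = k'" by (metis length_word add_right_cancel)
  then show "i = i' \<and> k = k' \<and> j = j'" using eq by (simp add: word_def)
qed simp

lemma expand_first [simp]: "F.expand (word i k j) 0 = word (Suc i) (Suc k) j"
  by (simp add: F.expand_def F.halves_def word_def end_split_def)

lemma expand_last [simp]: "F.expand (word i k j) (Suc k) = word i (Suc k) (Suc j)"
proof -
  have "F.expand (((2 * i + 1) # replicate k 0) @ (2 * j + 2) # []) (Suc k)
      = ((2 * i + 1) # replicate k 0) @ F.halves (2 * j + 2) @ []"
    by (rule F.expand_decomp) simp
  then show ?thesis
    by (simp add: F.halves_def end_split_def word_def replicate_append_same)
qed

lemma expand_middle [simp]:
  assumes "0 < m" "m \<le> k"
  shows "F.expand (word i k j) m = word i (Suc k) j"
proof -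
  obtain a where a: "m = Suc a" using assms(1) by (cases m) auto
  obtain b where b: "k = Suc a + b" using assms(2) a by (metis le_iff_add)
  have r: "replicate (a + n) (0::nat) = replicate a 0 @ replicate n 0" for n
    by (rule replicate_add)
  have "word i k j = ((2 * i + 1) # replicate a 0) @ 0 # (replicate b 0 @ [2 * j + 2])"
    using r[of "Suc b"] by (simp add: word_def b)
  also have "F.expand \<dots> m = ((2 * i + 1) # replicate a 0) @ F.halves 0 @ replicate b 0 @ [2 * j + 2]"
    by (rule F.expand_decomp) (simp add: a)
  also have "\<dots> = word i (Suc k) j"
    using r[of "Suc (Suc b)"] by (simp add: word_def b F.halves_def end_split_def)
  finally show ?thesis .
qed

lemma position_cases:
  assumes "m < length (word i k j)"
  obtains "m = 0" | "0 < m" "m \<le> k" | "m = Suc k"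
  using assms by fastforce

abbreviation base :: "nat list" where
  "base \<equiv> word 0 0 0"

section \<open>Supports of loops\<close>

text \<open>
  A positive path from \<open>base\<close> to \<open>word i k j\<close> is linear with slopes \<open>2 ^ i\<close> and \<open>2 ^ j\<close> near the ends of
  \<open>[0, 2]\<close>. So the end letters make sure that loops at \<open>base\<close> have slope 1 there.
\<close>

definition end_germs :: "nat \<Rightarrow> nat \<Rightarrow> nat \<Rightarrow> (real \<Rightarrow> real) \<Rightarrow> bool" where
  "end_germs i k j f \<longleftrightarrow>
     (\<forall>t\<ge>0. 2 ^ i * t \<le> 1 \<longrightarrow> f t = 2 ^ i * t)
   \<and> (\<forall>t\<ge>0. 2 ^ j * t \<le> 1 \<longrightarrow> f (2 - t) = real (k + 2) - 2 ^ j * t)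
   \<and> (\<forall>t\<le>0. f t = t) \<and> (\<forall>t\<ge>2. f t = t + real k)"

lemma end_germsI:
  assumes "\<And>t. 0 \<le> t \<Longrightarrow> 2 ^ i * t \<le> 1 \<Longrightarrow> f t = 2 ^ i * t"
    "\<And>t. 0 \<le> t \<Longrightarrow> 2 ^ j * t \<le> 1 \<Longrightarrow> f (2 - t) = real (k + 2) - 2 ^ j * t"
    "\<And>t. t \<le> 0 \<Longrightarrow> f t = t" "\<And>t. t \<ge> 2 \<Longrightarrow> f t = t + real k"
  shows "end_germs i k j f"
  using assms unfolding end_germs_def by blast

lemma end_germsD:
  assumes "end_germs i k j f"
  shows "0 \<le> t \<Longrightarrow> 2 ^ i * t \<le> 1 \<Longrightarrow> f t = 2 ^ i * t"
    "0 \<le> t \<Longrightarrow> 2 ^ j * t \<le> 1 \<Longrightarrow> f (2 - t) = real (k + 2) - 2 ^ j * t"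
    "t \<le> 0 \<Longrightarrow> f t = t" "t \<ge> 2 \<Longrightarrow> f t = t + real k"
  using assms unfolding end_germs_def by blast+

lemma end_germs_first:
  assumes "end_germs i k j f"
  shows "end_germs (Suc i) (Suc k) j (stretch 0 \<circ> f)"
proof (rule end_germsI)
  fix t :: real assume t: "0 \<le> t" "2 ^ Suc i * t \<le> 1"
  have "0 \<le> 2 ^ i * t" "2 * (2 ^ i * t) \<le> 1" using t by simp_all
  show "(stretch 0 \<circ> f) t = 2 ^ Suc i * t"
    using end_germsD(1)[OF assms(1), of t] t stretch_inside[of 0 "2 ^ i * t"] \<open>2 * (2 ^ i * t) \<le> 1\<close> \<open>0 \<le> 2 ^ i * t\<close> by simp
next
  fix t :: real assume t: "0 \<le> t" "2 ^ j * t \<le> 1"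
  show "(stretch 0 \<circ> f) (2 - t) = real (Suc k + 2) - 2 ^ j * t"
    using end_germsD(2)[OF assms(1) t] t by (simp add: stretch_above)
next
  fix t :: real assume t: "t \<le> 0"
  show "(stretch 0 \<circ> f) t = t"
    using end_germsD(3)[OF assms(1) t] t by (simp add: stretch_below)
next
  fix t :: real assume t: "2 \<le> t"
  show "(stretch 0 \<circ> f) t = t + real (Suc k)"
    using end_germsD(4)[OF assms(1) t] t by (simp add: stretch_above)
qed

lemma end_germs_last:
  assumes "end_germs i k j f"
  shows "end_germs i (Suc k) (Suc j) (stretch (Suc k) \<circ> f)"
proof (rule end_germsI)
  fix t :: real assume t: "0 \<le> t" "2 ^ i * t \<le> 1"
  show "(stretch (Suc k) \<circ> f) t = 2 ^ i * t"
    using end_germsD(1)[OF assms(1) t] t by (simp add: stretch_below)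
next
  fix t :: real assume t: "0 \<le> t" "2 ^ Suc j * t \<le> 1"
  have "0 \<le> 2 ^ j * t" "2 * (2 ^ j * t) \<le> 1" using t by simp_all
  show "(stretch (Suc k) \<circ> f) (2 - t) = real (Suc k + 2) - 2 ^ Suc j * t"
    using end_germsD(2)[OF assms(1), of t] t stretch_inside[of "Suc k" "real (k + 2) - 2 ^ j * t"] \<open>2 * (2 ^ j * t) \<le> 1\<close> \<open>0 \<le> 2 ^ j * t\<close> by simp
next
  fix t :: real assume t: "t \<le> 0"
  show "(stretch (Suc k) \<circ> f) t = t"
    using end_germsD(3)[OF assms(1) t] t by (simp add: stretch_below)
next
  fix t :: real assume t: "2 \<le> t"
  show "(stretch (Suc k) \<circ> f) t = t + real (Suc k)"
    using end_germsD(4)[OF assms(1) t] t by (simp add: stretch_above)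
qed

lemma end_germs_middle:
  assumes "end_germs i k j f" "0 < m" "m \<le> k"
  shows "end_germs i (Suc k) j (stretch m \<circ> f)"
proof (rule end_germsI)
  fix t :: real assume t: "0 \<le> t" "2 ^ i * t \<le> 1"
  show "(stretch m \<circ> f) t = 2 ^ i * t"
    using end_germsD(1)[OF assms(1) t] t assms(2) by (simp add: stretch_below)
next
  fix t :: real assume t: "0 \<le> t" "2 ^ j * t \<le> 1"
  show "(stretch m \<circ> f) (2 - t) = real (Suc k + 2) - 2 ^ j * t"
    using end_germsD(2)[OF assms(1) t] t assms(3) by (simp add: stretch_above)
next
  fix t :: real assume t: "t \<le> 0"
  show "(stretch m \<circ> f) t = t"
    using end_germsD(3)[OF assms(1) t] t by (simp add: stretch_below)
next
  fix t :: real assume t: "2 \<le> t"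
  show "(stretch m \<circ> f) t = t + real (Suc k)"
    using end_germsD(4)[OF assms(1) t] t assms(3) by (simp add: stretch_above)
qed

lemma positive_end_germs:
  assumes "F.admissible base ms"
  obtains i k j where "F.expand_all base ms = word i k j"
    "end_germs i k j (path_map (F.expansions base ms))"
proof -
  have "\<exists>i k j. F.expand_all base ms = word i k j \<and> end_germs i k j (path_map (F.expansions base ms))"
    using assms
  proof (induction ms rule: rev_induct)
    case Nil
    have "end_germs 0 0 0 (path_map (F.expansions base []))" by (intro end_germsI) auto
    then show ?case by (metis F.expand_all.simps(1))
  next
    case (snoc m ms)
    then have adm: "F.admissible base ms" "m < length (F.expand_all base ms)"
      by (auto simp: F.admissible_append)
    obtain i k j where w: "F.expand_all base ms = word i k j"
      and g: "end_germs i k j (path_map (F.expansions base ms))"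
      using snoc.IH[OF adm(1)] by blast
    have f: "path_map (F.expansions base (ms @ [m])) = stretch m \<circ> path_map (F.expansions base ms)"
      using adm by (simp add: F.expansions_append path_map_append F.edge_map_expansion)
    have e: "F.expand_all base (ms @ [m]) = F.expand (word i k j) m"
      by (simp add: F.expand_all_append w)
    have "m < length (word i k j)" using adm w by simp
    then show ?case
    proof (cases rule: position_cases)
      case 1
      show ?thesis unfolding f e unfolding 1 expand_first using end_germs_first[OF g] by blast
    next
      case 2
      show ?thesis unfolding f e unfolding expand_middle[OF 2] using end_germs_middle[OF g 2] by blast
    next
      case 3
      show ?thesis unfolding f e unfolding 3 expand_last using end_germs_last[OF g] by blast
    qed
  qed
  then show thesis using that by blast
qed

text \<open>
  The two intervals of length \<open>1 / 2 ^ N\<close> that remain are those of the end letters after \<open>N\<close> splittings.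
\<close>

definition supported :: "nat \<Rightarrow> (real \<Rightarrow> real) \<Rightarrow> bool" where
  "supported N f \<longleftrightarrow> (\<forall>t. f t \<noteq> t \<longrightarrow> 1 / 2 ^ N \<le> t \<and> t \<le> 2 - 1 / 2 ^ N)"

lemma supported_mono:
  assumes "supported M f" "M \<le> N"
  shows "supported N f"
proof -
  have "1 / 2 ^ N \<le> (1 / 2 ^ M :: real)"
    using assms(2) by (intro divide_left_mono power_increasing) auto
  then show ?thesis using assms(1) unfolding supported_def by fastforce
qed

lemma supported_ends:
  assumes "supported N f"
  shows "f 0 = 0" "f 2 = 2" "f t \<noteq> t \<Longrightarrow> 0 < t" "f t \<noteq> t \<Longrightarrow> t < 2"
proof -
  have p: "(0::real) < 1 / 2 ^ N" by simp
  then have "\<not> 1 / 2 ^ N \<le> (0::real)" "\<not> (2::real) \<le> 2 - 1 / 2 ^ N" by linarith+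
  then show "f 0 = 0" "f 2 = 2" using assms unfolding supported_def by blast+
  assume "f t \<noteq> t"
  then have "1 / 2 ^ N \<le> t" "t \<le> 2 - 1 / 2 ^ N" using assms unfolding supported_def by blast+
  with p show "0 < t" "t < 2" by linarith+
qed

text \<open>
  Both positive paths of the normal form of a loop end in the same word, so by the end letters they have
  the same germs at 0 and at 2, and these cancel.
\<close>

lemma loop_supported:
  assumes "edge_path F.SC base es base"
  shows "\<exists>N. supported N (path_map es)"
proof -
  obtain ms ns where f: "F.admissible base ms" "F.admissible base ns"
      "F.expand_all base ms = F.expand_all base ns"
      "homotopic_paths F.SC base base es (F.expansions base ms @ rev_path F.SC (F.expansions base ns))"
    using F.positive_negative_form[OF assms] by blast
  let ?f = "path_map (F.expansions base ms)" and ?g = "path_map (F.expansions base ns)"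
  have fixed: "path_map es t = t" if "?f t = ?g t" for t
    using F.path_map_rev_path(1)[OF F.edge_path_expansions[OF f(2)], of t] that
      F.path_map_homotopic[OF f(4)] by (simp add: path_map_append)
  obtain i k j where w: "F.expand_all base ms = word i k j" and g: "end_germs i k j ?f"
    using positive_end_germs[OF f(1)] .
  have g': "end_germs i k j ?g"
    by (rule positive_end_germs[OF f(2)]) (use w f(3) in auto)
  have "supported (i + j) (path_map es)"
    unfolding supported_def
  proof (intro allI impI conjI; rule ccontr)
    fix t assume ne: "path_map es t \<noteq> t" and "\<not> 1 / 2 ^ (i + j) \<le> t"
    then have "t < 1 / 2 ^ (i + j)" by simp
    also have "\<dots> \<le> 1 / 2 ^ i" by (intro divide_left_mono power_increasing) auto
    finally have "2 ^ i * t \<le> 1" by (simp add: field_simps)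
    then have "?f t = ?g t" using end_germsD(1,3)[OF g, of t] end_germsD(1,3)[OF g', of t] by linarith
    with ne fixed show False by blast
  next
    fix t assume ne: "path_map es t \<noteq> t" and "\<not> t \<le> 2 - 1 / 2 ^ (i + j)"
    then have "2 - t < 1 / 2 ^ (i + j)" by simp
    also have "\<dots> \<le> 1 / 2 ^ j" by (intro divide_left_mono power_increasing) auto
    finally have "2 ^ j * (2 - t) \<le> 1" by (simp add: field_simps)
    then have "?f t = ?g t"
      using end_germsD(2)[OF g, of "2 - t"] end_germsD(2)[OF g', of "2 - t"]
        end_germsD(4)[OF g, of t] end_germsD(4)[OF g', of t] by (cases "t \<le> 2") auto
    with ne fixed show False by blast
  qed
  then show ?thesis ..
qed

section \<open>Moving intervals\<close>

definition carries :: "nat list \<Rightarrow> real \<Rightarrow> real \<Rightarrow> nat list \<Rightarrow> real \<Rightarrow> real \<Rightarrow> bool" where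
  "carries w l r w' l' r' \<longleftrightarrow> (\<exists>es. edge_path F.SC w es w' \<and> path_map es l = l' \<and> path_map es r = r')"

lemma carries_refl: "w \<noteq> [] \<Longrightarrow> carries w l r w l r"
  unfolding carries_def by (intro exI[of _ "[]"]) (simp add: edge_path_Nil F.verts_SC)

lemma carries_trans:
  "carries w l r w' l' r' \<Longrightarrow> carries w' l' r' w'' l'' r'' \<Longrightarrow> carries w l r w'' l'' r''"
  unfolding carries_def by (metis F.edge_path_append path_map_append comp_apply)

lemma carries_sym: "carries w l r w' l' r' \<Longrightarrow> carries w' l' r' w l r"
  unfolding carries_def using F.edge_path_rev_path F.path_map_rev_path(1) by blast

lemma carries_expansion:
  "m < length w \<Longrightarrow> carries w l r (F.expand w m) (stretch m l) (stretch m r)"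
  unfolding carries_def
  by (intro exI[of _ "[F.expansion w m]"]) (simp add: F.edge_path_expansion F.edge_map_expansion)

text \<open>
  Splitting both end letters \<open>N\<close> times separates the intervals \<open>[0, 1 / 2 ^ N]\<close> and \<open>[2 - 1 / 2 ^ N, 2]\<close>, which
  belong to the end letters, from the rest, which is filled by letters \<open>0\<close>.
\<close>

lemma carries_to_middle: "carries base (1 / 2 ^ N) (2 - 1 / 2 ^ N) (word N (2 * N) N) 1 (2 * real N + 1)"
proof -
  have "\<exists>ms. F.admissible base ms \<and> F.expand_all base ms = word N (2 * N) N"
  proof (induction N)
    case 0
    show ?case by (intro exI[of _ "[]"]) simp
  next
    case (Suc N)
    then obtain ms where "F.admissible base ms" "F.expand_all base ms = word N (2 * N) N" by blast
    then show ?case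
      by (intro exI[of _ "ms @ [0, Suc (Suc (2 * N))]"]) (simp add: F.admissible_append F.expand_all_append)
  qed
  then obtain ms where ms: "F.admissible base ms" "F.expand_all base ms = word N (2 * N) N" by blast
  let ?f = "path_map (F.expansions base ms)"
  have g: "end_germs N (2 * N) N ?f"
    by (rule positive_end_germs[OF ms(1)]) (use ms(2) in auto)
  have "?f (1 / 2 ^ N) = 1" "?f (2 - 1 / 2 ^ N) = 2 * real N + 1"
    using end_germsD(1,2)[OF g, of "1 / 2 ^ N"] by auto
  then show ?thesis
    unfolding carries_def using F.edge_path_expansions[OF ms(1)]
    by (intro exI[of _ "F.expansions base ms"]) (simp add: ms(2))
qed

lemma carries_collapse: "carries (word i (Suc m) j) 1 (real m + 2) (word i 1 j) 1 2"
proof (induction m)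
  case 0
  show ?case by (simp add: carries_refl)
next
  case (Suc m)
  have "carries (word i (Suc m) j) 1 (real m + 2) (word i (Suc (Suc m)) j) 1 (real (Suc m) + 2)"
    using carries_expansion[of 1 "word i (Suc m) j" 1 "real m + 2"] by (simp add: stretch_above stretch_below add_ac)
  from carries_trans[OF carries_sym[OF this] Suc.IH] show ?case .
qed

text \<open>
  Words \<open>word i (s + 1 + t) j\<close> with a marked letter \<open>0\<close>, which has \<open>s\<close> letters \<open>0\<close> on its left and \<open>t\<close> on its
  right. Rewriting on the two sides of the marked letter connects all of them.
\<close>

definition linked :: "nat \<Rightarrow> nat \<Rightarrow> nat \<Rightarrow> nat \<Rightarrow> nat \<Rightarrow> nat \<Rightarrow> nat \<Rightarrow> nat \<Rightarrow> bool" where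
  "linked i s t j i' s' t' j' \<longleftrightarrow>
     carries (word i (s + 1 + t) j) (real s + 1) (real s + 2)
       (word i' (s' + 1 + t') j') (real s' + 1) (real s' + 2)"

lemma linked_trans: "linked i s t j i' s' t' j' \<Longrightarrow> linked i' s' t' j' a b c d \<Longrightarrow> linked i s t j a b c d"
  unfolding linked_def by (rule carries_trans)

lemma linked_sym: "linked i s t j i' s' t' j' \<Longrightarrow> linked i' s' t' j' i s t j"
  unfolding linked_def by (rule carries_sym)

lemma linked_steps:
  "linked i s t j (Suc i) (Suc s) t j"
  "linked i (Suc s) t j i (Suc (Suc s)) t j"
  "linked i s t j i s (Suc t) (Suc j)"
  "linked i s (Suc t) j i s (Suc (Suc t)) j"
proof -
  note [simp] = stretch_above stretch_below linked_def
  show "linked i s t j (Suc i) (Suc s) t j"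
    using carries_expansion[of 0 "word i (s + 1 + t) j" "real s + 1" "real s + 2"]
    by (simp add: add_ac)
  show "linked i (Suc s) t j i (Suc (Suc s)) t j"
    using carries_expansion[of 1 "word i (Suc s + 1 + t) j" "real (Suc s) + 1" "real (Suc s) + 2"]
    by (simp add: add_ac)
  show "linked i s t j i s (Suc t) (Suc j)"
    using carries_expansion[of "Suc (s + 1 + t)" "word i (s + 1 + t) j" "real s + 1" "real s + 2"]
      expand_last[of i "s + 1 + t" j]
    by simp
  show "linked i s (Suc t) j i s (Suc (Suc t)) j"
    using carries_expansion[of "s + 2" "word i (s + 1 + Suc t) j" "real s + 1" "real s + 2"]
    by simp
qed

lemma linked_left: "linked i s t j 0 1 t j"
proof -
  have refl: "linked i s t j i s t j" for i s
    by (simp add: linked_def carries_refl)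
  have down: "linked i (Suc s) t j i 1 t j" for i s
  proof (induction s)
    case 0
    show ?case using refl[of i 1] by simp
  next
    case (Suc s)
    show ?case by (rule linked_trans[OF linked_sym[OF linked_steps(2)] Suc.IH])
  qed
  have up: "linked i s t j (Suc i) 1 t j" for i s
    by (rule linked_trans[OF linked_steps(1) down])
  have "linked i 1 t j 0 1 t j" for i
  proof (induction i)
    case 0
    show ?case by (rule refl)
  next
    case (Suc i)
    show ?case by (rule linked_trans[OF linked_sym[OF up] Suc.IH])
  qed
  then show ?thesis by (rule linked_trans[OF up])
qed

lemma linked_right: "linked i s t j i s 1 0"
proof -
  have refl: "linked i s t j i s t j" for t j
    by (simp add: linked_def carries_refl)
  have down: "linked i s (Suc t) j i s 1 j" for t j
  proof (induction t)
    case 0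
    show ?case using refl[of 1 j] by simp
  next
    case (Suc t)
    show ?case by (rule linked_trans[OF linked_sym[OF linked_steps(4)] Suc.IH])
  qed
  have up: "linked i s t j i s 1 (Suc j)" for t j
    by (rule linked_trans[OF linked_steps(3) down])
  have "linked i s 1 j i s 1 0" for j
  proof (induction j)
    case 0
    show ?case by (rule refl)
  next
    case (Suc j)
    show ?case by (rule linked_trans[OF linked_sym[OF up] Suc.IH])
  qed
  then show ?thesis by (rule linked_trans[OF up])
qed

lemma linked_all: "linked i s t j i' s' t' j'"
  by (rule linked_trans[OF linked_trans[OF linked_left linked_right]
        linked_sym[OF linked_trans[OF linked_left linked_right]]])

text \<open>Repeatedly splitting the letter whose interval contains \<open>x\<close> singles out small dyadic intervals around \<open>x\<close>.\<close>

lemma dyadic_subdivision: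
  assumes "0 \<le> x" "x \<le> 2"
  shows "\<exists>ms m c. F.admissible base ms \<and> m < length (F.expand_all base ms) \<and> c \<le> x \<and> x \<le> c + 1 / 2 ^ n
    \<and> (\<forall>u\<in>{0..1}. path_map (F.expansions base ms) (c + u / 2 ^ n) = real m + u)"
proof (induction n)
  case 0
  define m where "m = (if x \<le> 1 then 0 else 1 :: nat)"
  have "real m \<le> x" "x \<le> real m + 1 / 2 ^ 0" "m < length base" using assms by (auto simp: m_def)
  then show ?case
    by - (rule exI[of _ "[]"], rule exI[of _ m], rule exI[of _ "real m"], simp)
next
  case (Suc n)
  then obtain ms m c where IH: "F.admissible base ms" "m < length (F.expand_all base ms)" "c \<le> x" "x \<le> c + 1 / 2 ^ n"
      "\<And>u. 0 \<le> u \<Longrightarrow> u \<le> 1 \<Longrightarrow> path_map (F.expansions base ms) (c + u / 2 ^ n) = real m + u"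
    by auto
  let ?ms = "ms @ [m]"
  have adm: "F.admissible base ?ms" "length (F.expand_all base ?ms) = Suc (length (F.expand_all base ms))"
    using IH(1,2) by (simp_all add: F.admissible_append F.expand_all_append)
  have f: "path_map (F.expansions base ?ms) (c + u / 2 ^ n) = real m + 2 * u" if "0 \<le> u" "u \<le> 1" for u
    using IH(1,2) IH(5)[OF that] that
    by (simp add: F.expansions_append path_map_append F.edge_map_expansion stretch_def)
  have half: "1 / 2 ^ n = 2 * (1 / 2 ^ Suc n :: real)" by simp
  show ?case
  proof (cases "x \<le> c + 1 / 2 ^ Suc n")
    case True
    have "path_map (F.expansions base ?ms) (c + u / 2 ^ Suc n) = real m + u" if "u \<in> {0..1}" for u
      using f[of "u / 2"] that by simp
    moreover have "m < length (F.expand_all base ?ms)" using adm(2) IH(2) by simp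
    ultimately show ?thesis using adm(1) IH(3) True by blast
  next
    case False
    have "path_map (F.expansions base ?ms) ((c + 1 / 2 ^ Suc n) + u / 2 ^ Suc n) = real (Suc m) + u"
      if "u \<in> {0..1}" for u
    proof -
      have "(c + 1 / 2 ^ Suc n) + u / 2 ^ Suc n = c + ((1 + u) / 2) / 2 ^ n" by (simp add: field_simps)
      then have "path_map (F.expansions base ?ms) ((c + 1 / 2 ^ Suc n) + u / 2 ^ Suc n) = real m + 2 * ((1 + u) / 2)"
        using f[of "(1 + u) / 2"] that by (simp only: atLeastAtMost_iff) simp
      then show ?thesis by (simp add: field_simps)
    qed
    moreover have "c + 1 / 2 ^ Suc n \<le> x" "x \<le> c + 1 / 2 ^ Suc n + 1 / 2 ^ Suc n"
      using IH(4) False half by linarith+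
    moreover have "Suc m < length (F.expand_all base ?ms)" using adm(2) IH(2) by simp
    ultimately show ?thesis using adm(1) by blast
  qed
qed

text \<open>
  The middle part of \<open>base\<close> is collapsed to one letter \<open>0\<close>, which is then turned into the letter that a fine
  subdivision of \<open>base\<close> has inside the target interval. That letter is not an end letter, since its interval
  avoids 0 and 2. The ends are split \<open>N + 1\<close> times because for \<open>N = 0\<close> there is no letter \<open>0\<close> to collapse to.
\<close>

lemma compress_into_interval:
  assumes "0 \<le> a" "a < b" "b \<le> 2"
  shows "\<exists>es. edge_path F.SC base es base \<and> a < path_map es (1 / 2 ^ N) \<and> path_map es (2 - 1 / 2 ^ N) < b"
proof -
  define x where "x = (a + b) / 2"
  obtain n where n: "1 / 2 ^ n < (b - a) / 2"
    using real_arch_pow_inv[of "(b - a) / 2" "1 / 2"] assms by (auto simp: power_one_over)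
  obtain ms m c where d: "F.admissible base ms" "m < length (F.expand_all base ms)" "c \<le> x" "x \<le> c + 1 / 2 ^ n"
      "\<forall>u\<in>{0..1}. path_map (F.expansions base ms) (c + u / 2 ^ n) = real m + u"
    using dyadic_subdivision[of x n] assms by (auto simp: x_def)
  let ?f = "path_map (F.expansions base ms)" and ?d = "c + 1 / 2 ^ n"
  have ab: "a < c" "?d < b"
  proof -
    define e :: real where "e = 1 / 2 ^ n"
    have "2 * e < b - a" "2 * c \<le> a + b" "a + b \<le> 2 * c + 2 * e"
      using n d(3,4) unfolding x_def e_def[symmetric] by (simp_all add: field_simps)
    then have "a < c" "c + e < b" by linarith+
    then show "a < c" "?d < b" by (simp_all add: e_def)
  qed
  have f: "?f c = real m" "?f ?d = real m + 1"
    using bspec[OF d(5), of 0] bspec[OF d(5), of 1] by auto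
  obtain i k j where w: "F.expand_all base ms = word i k j" and g: "end_germs i k j ?f"
    using positive_end_germs[OF d(1)] .
  have "?f 0 = 0" "?f 2 = real k + 2" using end_germsD(3,4)[OF g] by auto
  moreover have "?f 0 < ?f c" "?f ?d < ?f 2" using ab assms by (auto simp: path_map_less_iff)
  ultimately have "0 < real m" "real m + 1 < real k + 2" using f by auto
  then have m: "0 < m" "m \<le> k" by linarith+
  define s t where "s = m - 1" and "t = k - m"
  have st: "m = s + 1" "k = s + 1 + t" using m by (auto simp: s_def t_def)
  have 1: "carries base c ?d (word i (s + 1 + t) j) (real s + 1) (real s + 2)"
    unfolding carries_def using F.edge_path_expansions[OF d(1)] f w st
    by (intro exI[of _ "F.expansions base ms"]) simp
  have 2: "carries (word (Suc N) 1 (Suc N)) 1 2 (word i (s + 1 + t) j) (real s + 1) (real s + 2)"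
    using linked_all[of "Suc N" 0 0 "Suc N" i s t j] by (simp add: linked_def)
  have 3: "carries base (1 / 2 ^ Suc N) (2 - 1 / 2 ^ Suc N) (word (Suc N) 1 (Suc N)) 1 2"
  proof -
    have "carries (word (Suc N) (2 * Suc N) (Suc N)) 1 (2 * real (Suc N) + 1) (word (Suc N) 1 (Suc N)) 1 2"
      using carries_collapse[of "Suc N" "Suc (2 * N)" "Suc N"] by (simp add: algebra_simps)
    from carries_trans[OF carries_to_middle this] show ?thesis .
  qed
  from carries_trans[OF carries_trans[OF 3 2] carries_sym[OF 1]] obtain es where es: "edge_path F.SC base es base" "path_map es (1 / 2 ^ Suc N) = c"
      "path_map es (2 - 1 / 2 ^ Suc N) = ?d"
    unfolding carries_def by blast
  have "(1 / 2 ^ Suc N :: real) \<le> 1 / 2 ^ N" by (simp add: field_simps)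
  then have "path_map es (1 / 2 ^ Suc N) \<le> path_map es (1 / 2 ^ N)"
      "path_map es (2 - 1 / 2 ^ N) \<le> path_map es (2 - 1 / 2 ^ Suc N)"
    unfolding path_map_le_iff by linarith+
  with es ab show ?thesis by (intro exI[of _ es]) simp
qed

section \<open>Normal subgroups of the diagram group\<close>

abbreviation simple_diagram_group :: "nat squier_edge list set monoid" where
  "simple_diagram_group \<equiv> squier_diagram_group F.presentation base"

lemma simple_diagram_group_def: "simple_diagram_group = fundamental_group F.SC base"
  by (simp add: squier_diagram_group_def)

lemma group_simple_diagram_group: "group simple_diagram_group"
  unfolding simple_diagram_group_def by (rule F.group_fundamental_group) (simp add: F.verts_SC)

lemma simple_diagram_group_cases:
  assumes "x \<in> carrier simple_diagram_group"
  obtains es where "edge_path F.SC base es base" "x = F.path_class base es"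
  using assms by (auto simp: simple_diagram_group_def F.carrier_fundamental_group)

definition class_map :: "nat squier_edge list set \<Rightarrow> real \<Rightarrow> real" where
  "class_map x = path_map (SOME es. es \<in> x)"

lemma class_map_path_class:
  assumes "edge_path F.SC base es base"
  shows "class_map (F.path_class base es) = path_map es"
proof -
  have "es \<in> F.path_class base es" using assms by (simp add: homotopy_rel_def htp_refl)
  then have "(SOME fs. fs \<in> F.path_class base es) \<in> F.path_class base es" by (rule someI)
  then show ?thesis
    unfolding class_map_def homotopy_rel_def by (simp add: F.path_map_homotopic)
qed

lemma class_map_supported:
  assumes "x \<in> carrier simple_diagram_group"
  shows "\<exists>N. supported N (class_map x)"
  using assms by (rule simple_diagram_group_cases) (simp add: class_map_path_class loop_supported)

lemma class_map_less_iff: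
  assumes "x \<in> carrier simple_diagram_group"
  shows "class_map x s < class_map x t \<longleftrightarrow> s < t"
  using assms by (rule simple_diagram_group_cases) (simp add: class_map_path_class path_map_less_iff)

lemma class_map_mult:
  assumes "x \<in> carrier simple_diagram_group" "y \<in> carrier simple_diagram_group"
  shows "class_map (x \<otimes>\<^bsub>simple_diagram_group\<^esub> y) = class_map y \<circ> class_map x"
proof -
  obtain es fs where "edge_path F.SC base es base" "x = F.path_class base es"
      "edge_path F.SC base fs base" "y = F.path_class base fs"
    using assms simple_diagram_group_cases by metis
  then show ?thesis
    by (simp add: simple_diagram_group_def F.fundamental_group_mult class_map_path_class
        F.edge_path_append[of base es base fs base] path_map_append)
qed

lemma class_map_faithful:
  assumes "x \<in> carrier simple_diagram_group" "class_map x = id"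
  shows "x = \<one>\<^bsub>simple_diagram_group\<^esub>"
proof -
  obtain es where es: "edge_path F.SC base es base" "x = F.path_class base es"
    using assms(1) by (rule simple_diagram_group_cases)
  then show ?thesis
    using F.loops_faithful[OF es(1)] assms(2)
    by (simp add: class_map_path_class simple_diagram_group_def F.one_fundamental_group F.path_class_eq_iff)
qed

text \<open>
  A nontrivial element moves a point and so, by monotonicity, a whole interval off itself; any two supports can be
  compressed into that interval.
\<close>

lemma displacement:
  assumes a: "a \<in> carrier simple_diagram_group" and b: "b \<in> carrier simple_diagram_group"
    and c: "c \<in> carrier simple_diagram_group" "c \<noteq> \<one>\<^bsub>simple_diagram_group\<^esub>"
  shows "\<exists>h\<in>carrier simple_diagram_group. \<forall>s\<in>{t. class_map a t \<noteq> t \<or> class_map b t \<noteq> t}.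
    \<forall>t\<in>{t. class_map a t \<noteq> t \<or> class_map b t \<noteq> t}. class_map c (class_map h s) \<noteq> class_map h t"
proof -
  obtain M M' where "supported M (class_map a)" "supported M' (class_map b)"
    using class_map_supported a b by meson
  then have N: "supported (M + M') (class_map a)" "supported (M + M') (class_map b)"
    by (auto elim: supported_mono)
  obtain N' where N': "supported N' (class_map c)" using class_map_supported c by blast
  obtain x where x: "class_map c x \<noteq> x" using class_map_faithful c by fastforce
  define y where "y = class_map c x"
  have x02: "0 < x" "x < 2" using supported_ends(3,4)[OF N' x] .
  then have y02: "0 < y" "y < 2"
    using class_map_less_iff[OF c(1), of 0 x] class_map_less_iff[OF c(1), of x 2] supported_ends(1,2)[OF N']
    by (auto simp: y_def)
  \<comment> \<open>An interval with end point \<open>x\<close> that is short enough to be disjoint from its image, by monotonicity.\<close>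
  obtain l r where lr: "0 \<le> l" "l < r" "r \<le> 2"
    and off: "\<And>s t. l < s \<Longrightarrow> s < r \<Longrightarrow> l < t \<Longrightarrow> t < r \<Longrightarrow> class_map c s \<noteq> t"
  proof (cases "x < y")
    case True
    have "class_map c s \<noteq> t" if "x < s" "t < (x + y) / 2" for s t
    proof -
      have "y < class_map c s" using that class_map_less_iff[OF c(1), of x s] by (simp add: y_def)
      moreover have "t < y" using that True by simp
      ultimately show ?thesis by simp
    qed
    then show ?thesis using that[of x "(x + y) / 2"] True x02 y02 by simp
  next
    case False
    then have "y < x" using x by (simp add: y_def)
    have "class_map c s \<noteq> t" if "s < x" "(x + y) / 2 < t" for s t
    proof -
      have "class_map c s < y" using that class_map_less_iff[OF c(1), of s x] by (simp add: y_def)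
      moreover have "y < t" using that \<open>y < x\<close> by simp
      ultimately show ?thesis by simp
    qed
    then show ?thesis using that[of "(x + y) / 2" x] \<open>y < x\<close> x02 y02 by simp
  qed
  obtain es where es: "edge_path F.SC base es base"
      "l < path_map es (1 / 2 ^ (M + M'))" "path_map es (2 - 1 / 2 ^ (M + M')) < r"
    using compress_into_interval[OF lr] by blast
  let ?h = "F.path_class base es"
  have h: "?h \<in> carrier simple_diagram_group" unfolding simple_diagram_group_def using es(1) by blast
  have inside: "l < class_map ?h t" "class_map ?h t < r" if "class_map a t \<noteq> t \<or> class_map b t \<noteq> t" for t
  proof -
    have t: "1 / 2 ^ (M + M') \<le> t" "t \<le> 2 - 1 / 2 ^ (M + M')"
      using N that unfolding supported_def by blast+
    have "path_map es (1 / 2 ^ (M + M')) \<le> path_map es t" "path_map es t \<le> path_map es (2 - 1 / 2 ^ (M + M'))"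
      using t by (simp_all add: path_map_le_iff)
    then show "l < class_map ?h t" "class_map ?h t < r"
      using es by (simp_all add: class_map_path_class)
  qed
  show ?thesis using h off inside by blast
qed

theorem derived_simple_diagram_group_subset_normal:
  assumes "N \<lhd> simple_diagram_group" "N \<noteq> {\<one>\<^bsub>simple_diagram_group\<^esub>}"
  shows "derived simple_diagram_group (carrier simple_diagram_group) \<subseteq> N"
proof (rule group.derived_subset_normal[OF group_simple_diagram_group _ class_map_mult class_map_faithful displacement assms])
  show "class_map \<one>\<^bsub>simple_diagram_group\<^esub> = id"
    using class_map_path_class[of "[]"]
    by (simp add: simple_diagram_group_def F.one_fundamental_group edge_path_Nil F.verts_SC)
qed

text \<open>
  Splitting the left end letter twice gives two adjacent letters \<open>0\<close>; splitting the first of them leads to the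
  same word as splitting the second, but to a different map.
\<close>

lemma simple_diagram_group_nontrivial: "carrier simple_diagram_group \<noteq> {\<one>\<^bsub>simple_diagram_group\<^esub>}"
proof
  assume triv: "carrier simple_diagram_group = {\<one>\<^bsub>simple_diagram_group\<^esub>}"
  let ?p = "F.expansions base [0, 0, 1]" and ?q = "F.expansions base [0, 0, 2]"
  have e: "F.expand_all base [0, 0, 1] = word 2 3 0" "F.expand_all base [0, 0, 2] = word 2 3 0"
    by (simp_all add: numeral_eq_Suc)
  have p: "edge_path F.SC base ?p (word 2 3 0)" and q: "edge_path F.SC base ?q (word 2 3 0)"
    using F.edge_path_expansions[of base "[0, 0, 1]"] F.edge_path_expansions[of base "[0, 0, 2]"]
    unfolding e by simp_all
  let ?l = "?p @ rev_path F.SC ?q"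
  have l: "edge_path F.SC base ?l base" by (rule F.edge_path_append[OF p F.edge_path_rev_path[OF q]])
  have "F.path_class base ?l \<in> carrier simple_diagram_group" "F.path_class base [] \<in> carrier simple_diagram_group"
    unfolding simple_diagram_group_def by (rule F.path_class_in_carrier, fact l, rule F.path_class_in_carrier)
      (simp add: edge_path_Nil F.verts_SC)
  then have "F.path_class base ?l = F.path_class base []" unfolding triv by simp
  then have "path_map ?l = id"
    using F.path_map_homotopic[of base base ?l "[]"] l by (simp add: F.path_class_eq_iff)
  then have "path_map (rev_path F.SC ?q) (path_map ?p t) = t" for t
    by (simp add: path_map_append fun_eq_iff)
  then have "path_map ?p t = path_map ?q t" for t
    using F.path_map_rev_path(2)[OF q] by metis
  moreover have "path_map ?p (1 / 2) \<noteq> path_map ?q (1 / 2)"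
    by (simp add: F.edge_map_expansion stretch_def)
  ultimately show False by blast
qed

section \<open>Perfectness\<close>

lemma (in comm_group) middle_cancel:
  assumes "y0 \<otimes> z2 = y1 \<otimes> z0" "y0 \<otimes> z3 = y2 \<otimes> z0" "y1 \<otimes> z3 = y2 \<otimes> z1"
    and c: "y0 \<in> carrier G" "y1 \<in> carrier G" "y2 \<in> carrier G"
      "z0 \<in> carrier G" "z1 \<in> carrier G" "z2 \<in> carrier G" "z3 \<in> carrier G"
  shows "z1 = z2"
proof -
  have "(y2 \<otimes> z0) \<otimes> z1 = (y1 \<otimes> z3) \<otimes> z0" using assms(3) c by (simp add: m_ac)
  also have "\<dots> = (y0 \<otimes> z2) \<otimes> z3" using c unfolding assms(1) by (simp add: m_ac)
  also have "\<dots> = (y2 \<otimes> z0) \<otimes> z2" using assms(2)[symmetric] c by (simp add: m_ac)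
  finally show ?thesis using c by (simp add: m_assoc)
qed

locale simple_diagram_group_abelian_image = abelian_image F.SC base A \<pi>
  for A :: "('c, 'd) monoid_scheme" (structure) and \<pi>
begin

definition edge_val :: "nat list \<Rightarrow> nat \<Rightarrow> 'c" where
  "edge_val w m = val w (F.expand w m) [F.expansion w m]"

lemma reachable_word: "reachable (word i k j)"
proof -
  have "reachable (word 1 1 0)"
    using reachable_step[OF reachable_base F.edge_path_expansion[of 0 base]] by simp
  moreover have "\<exists>es. edge_path F.SC (word 1 1 0) es (word i (Suc k) j)" for i k j
    using linked_all[of 1 0 0 0 i 0 k j] unfolding linked_def carries_def by auto
  ultimately have pos: "reachable (word i (Suc k) j)" for i k j
    using reachable_step by blast
  show ?thesis
  proof (cases k)
    case 0
    have "edge_path F.SC (word (Suc i) 1 j) (rev_path F.SC [F.expansion (word i 0 j) 0]) (word i 0 j)"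
      using F.edge_path_rev_path[OF F.edge_path_expansion[of 0 "word i 0 j"]] by simp
    then show ?thesis using reachable_step pos[of "Suc i" 0 j] 0 by simp
  next
    case (Suc n)
    then show ?thesis using pos by simp
  qed
qed

lemma edge_val_in_carrier [simp]: "m < k + 2 \<Longrightarrow> edge_val (word i k j) m \<in> carrier A"
  unfolding edge_val_def by (intro val_in_carrier reachable_word F.edge_path_expansion) simp

lemma edge_val_swap:
  assumes "m < n" "n < k + 2"
  shows "edge_val (word i k j) m \<otimes> edge_val (F.expand (word i k j) m) (Suc n)
    = edge_val (word i k j) n \<otimes> edge_val (F.expand (word i k j) n) m"
proof -
  let ?w = "word i k j"
  have split: "val ?w (F.expand (F.expand ?w a) b) (F.expansions ?w [a, b])
      = edge_val ?w a \<otimes> edge_val (F.expand ?w a) b" if "a < k + 2" "b < k + 3" for a b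
    using val_append[OF reachable_word F.edge_path_expansion[of a ?w] F.edge_path_expansion[of b "F.expand ?w a"]] that
    by (simp add: edge_val_def)
  have "n < length ?w" using assms by simp
  from val_homotopic[OF reachable_word F.homotopic_swap(2)[OF assms(1) this]]
  show ?thesis
    using split[of m "Suc n"] split[of n m] assms F.expand_swap[of m n ?w] by simp
qed

text \<open>
  Write \<open>y\<close> and \<open>z\<close> for the values at \<open>word i k j\<close> and at \<open>word i (Suc k) j\<close>. A cell of two middle letters
  expresses a quotient of two values \<open>y\<close> as a quotient of values \<open>z\<close> in which the second position is shifted:
  \<open>y\<^sub>m / y\<^sub>n = z\<^sub>m / z\<^sub>n\<^sub>+\<^sub>1\<close>. For \<open>m\<close>, \<open>m + 1\<close> and \<open>m + 2\<close> the quotients on the left multiply up, while those on the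
  right do so only if \<open>z\<^sub>m\<^sub>+\<^sub>1 = z\<^sub>m\<^sub>+\<^sub>2\<close>.
\<close>

lemma edge_val_middle_large:
  assumes "0 < m" "m + 2 \<le> k"
  shows "edge_val (word i (Suc k) j) (Suc m) = edge_val (word i (Suc k) j) (Suc (Suc m))"
  by (rule A.middle_cancel[where ?y0.0 = "edge_val (word i k j) m" and ?y1.0 = "edge_val (word i k j) (Suc m)"
        and ?y2.0 = "edge_val (word i k j) (Suc (Suc m))" and ?z0.0 = "edge_val (word i (Suc k) j) m"
        and ?z3.0 = "edge_val (word i (Suc k) j) (Suc (Suc (Suc m)))"])
    (use assms edge_val_swap[of m "Suc m" k i j] edge_val_swap[of m "Suc (Suc m)" k i j]
      edge_val_swap[of "Suc m" "Suc (Suc m)" k i j] in simp_all)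

text \<open>
  Splitting an end letter first does not affect quotients of values at middle positions, and it creates the
  space that the previous lemma asks for.
\<close>

lemma edge_val_middle_step:
  assumes "0 < m" "Suc m \<le> k"
  shows "edge_val (word i k j) m = edge_val (word i k j) (Suc m)"
proof -
  let ?V = "word i k j" and ?V1 = "word i (Suc k) (Suc j)" and ?V2 = "word (Suc i) (Suc (Suc k)) (Suc j)"
  have "edge_val ?V2 (Suc m) = edge_val ?V2 (Suc (Suc m))"
    using assms by (intro edge_val_middle_large) auto
  moreover have "edge_val ?V1 0 \<otimes> edge_val ?V2 (Suc n) = edge_val ?V1 n \<otimes> edge_val (word i (Suc (Suc k)) (Suc j)) 0"
    if "0 < n" "n \<le> k" for n
    using edge_val_swap[of 0 n "Suc k" i "Suc j"] that by simp
  ultimately have "edge_val ?V1 m \<otimes> edge_val (word i (Suc (Suc k)) (Suc j)) 0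
      = edge_val ?V1 (Suc m) \<otimes> edge_val (word i (Suc (Suc k)) (Suc j)) 0"
    using assms by (metis Suc_leD zero_less_Suc)
  then have "edge_val ?V1 m = edge_val ?V1 (Suc m)" using assms by simp
  moreover have "edge_val ?V n \<otimes> edge_val (word i (Suc k) j) (Suc (Suc k)) = edge_val ?V (Suc k) \<otimes> edge_val ?V1 n"
    if "0 < n" "n \<le> k" for n
    using edge_val_swap[of n "Suc k" k i j] that by simp
  ultimately have "edge_val ?V m \<otimes> edge_val (word i (Suc k) j) (Suc (Suc k))
      = edge_val ?V (Suc m) \<otimes> edge_val (word i (Suc k) j) (Suc (Suc k))"
    using assms by (metis Suc_leD zero_less_Suc)
  then show ?thesis using assms by simp
qed

lemma edge_val_middle: "0 < m \<Longrightarrow> m \<le> k \<Longrightarrow> edge_val (word i k j) m = edge_val (word i k j) 1"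
proof (induction m)
  case (Suc m)
  then show ?case using edge_val_middle_step[of m k i j] by (cases "m = 0") auto
qed simp

text \<open>
  The value of the positive path from \<open>base\<close> to \<open>word i (i + j + n) j\<close> that splits the left end letter \<open>i\<close>
  times, then the right end letter \<open>j\<close> times, and then \<open>n\<close> times the first letter \<open>0\<close>. Such a path exists
  only if \<open>n = 0\<close> or \<open>0 < i + j\<close>, since \<open>base\<close> contains no letter \<open>0\<close>.
\<close>

fun potential :: "nat \<Rightarrow> nat \<Rightarrow> nat \<Rightarrow> 'c" where
  "potential 0 0 0 = \<one>"
| "potential (Suc i) 0 0 = potential i 0 0 \<otimes> edge_val (word i i 0) 0"
| "potential i (Suc j) 0 = potential i j 0 \<otimes> edge_val (word i (i + j) j) (Suc (i + j))"
| "potential i j (Suc n) = potential i j n \<otimes> edge_val (word i (i + j + n) j) 1"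

lemma potential_in_carrier [simp]: "potential i j n \<in> carrier A"
  by (induction i j n rule: potential.induct) auto

lemma potential_last:
  assumes "n = 0 \<or> 0 < i + j"
  shows "potential i (Suc j) n = potential i j n \<otimes> edge_val (word i (i + j + n) j) (Suc (i + j + n))"
  using assms
proof (induction n)
  case 0
  show ?case by simp
next
  case (Suc n)
  let ?w = "word i (i + j + n) j"
  have pos: "1 \<le> i + j + n" using Suc.prems by linarith
  have "edge_val ?w 1 \<otimes> edge_val (word i (Suc (i + j + n)) j) (Suc (Suc (i + j + n)))
      = edge_val ?w (Suc (i + j + n)) \<otimes> edge_val (word i (Suc (i + j + n)) (Suc j)) 1"
    using edge_val_swap[of 1 "Suc (i + j + n)" "i + j + n" i j, OF less_Suc_eq_le[THEN iffD2, OF pos]] pos by simp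
  then show ?case using Suc by (simp add: \<pi>.H.m_assoc)
qed

lemma potential_first:
  assumes "n = 0 \<or> 0 < i + j"
  shows "potential (Suc i) j n = potential i j n \<otimes> edge_val (word i (i + j + n) j) 0"
  using assms
proof (induction n)
  case 0
  show ?case
  proof (induction j)
    case 0
    show ?case by simp
  next
    case (Suc j)
    let ?w = "word i (i + j) j"
    have "edge_val ?w 0 \<otimes> edge_val (word (Suc i) (Suc (i + j)) j) (Suc (Suc (i + j)))
        = edge_val ?w (Suc (i + j)) \<otimes> edge_val (word i (Suc (i + j)) (Suc j)) 0"
      using edge_val_swap[of 0 "Suc (i + j)" "i + j" i j] by simp
    then show ?case using Suc by (simp add: \<pi>.H.m_assoc)
  qed
next
  case (Suc n)
  let ?w = "word i (i + j + n) j" and ?v = "word (Suc i) (Suc (i + j + n)) j"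
  have pos: "1 \<le> i + j + n" using Suc.prems by linarith
  have "edge_val ?w 0 \<otimes> edge_val ?v (Suc 1) = edge_val ?w 1 \<otimes> edge_val (word i (Suc (i + j + n)) j) 0"
    using edge_val_swap[of 0 1 "i + j + n" i j] pos by simp
  moreover have "edge_val ?v (Suc 1) = edge_val ?v 1"
    using Suc.prems by (intro edge_val_middle) auto
  ultimately show ?case using Suc by (simp add: \<pi>.H.m_assoc)
qed

text \<open>
  The cells move splittings of end letters to the front, so that every positive path has the value of the path
  described by \<open>potential\<close>.
\<close>

lemma val_positive:
  assumes "F.admissible base ms"
  shows "\<exists>i j n. F.expand_all base ms = word i (i + j + n) j \<and> (n = 0 \<or> 0 < i + j)
    \<and> val base (F.expand_all base ms) (F.expansions base ms) = potential i j n"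
  using assms
proof (induction ms rule: rev_induct)
  case Nil
  have "val base base [] = \<one>"
    using val_loop[of "[]"] base \<pi>.hom_one by (simp add: edge_path_Nil one_fundamental_group)
  then show ?case by (intro exI[of _ "0 :: nat"]) simp
next
  case (snoc m ms)
  then have adm: "F.admissible base ms" "m < length (F.expand_all base ms)"
    by (auto simp: F.admissible_append)
  obtain i j n where IH: "F.expand_all base ms = word i (i + j + n) j" "n = 0 \<or> 0 < i + j"
      "val base (F.expand_all base ms) (F.expansions base ms) = potential i j n"
    using snoc.IH[OF adm(1)] by blast
  let ?w = "word i (i + j + n) j"
  have m: "m < length ?w" using adm(2) IH(1) by simp
  have e: "F.expand_all base (ms @ [m]) = F.expand ?w m"
    by (simp add: F.expand_all_append IH(1))
  have v: "val base (F.expand_all base (ms @ [m])) (F.expansions base (ms @ [m]))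
      = potential i j n \<otimes> edge_val ?w m"
    using val_append[OF reachable_base F.edge_path_expansions[OF adm(1)] F.edge_path_expansion[OF adm(2)]] IH
    by (simp add: F.expand_all_append F.expansions_append edge_val_def)
  show ?case
    using m
  proof (cases rule: position_cases)
    case 1
    then show ?thesis unfolding v unfolding e using potential_first[OF IH(2)]
      by - (rule exI[of _ "Suc i"], rule exI[of _ j], rule exI[of _ n], simp add: IH(2))
  next
    case 2
    then show ?thesis unfolding v unfolding e using edge_val_middle[OF 2] IH(2)
      by - (rule exI[of _ i], rule exI[of _ j], rule exI[of _ "Suc n"], auto)
  next
    case 3
    then show ?thesis unfolding v unfolding e using potential_last[OF IH(2)]
      by - (rule exI[of _ i], rule exI[of _ "Suc j"], rule exI[of _ n], simp add: IH(2))
  qed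
qed

theorem trivial_on_loops:
  assumes "edge_path F.SC base es base"
  shows "\<pi> (F.path_class base es) = \<one>"
proof -
  obtain ms ns where f: "F.admissible base ms" "F.admissible base ns"
      "F.expand_all base ms = F.expand_all base ns"
      "homotopic_paths F.SC base base es (F.expansions base ms @ rev_path F.SC (F.expansions base ns))"
    using F.positive_negative_form[OF assms] by blast
  let ?p = "F.expansions base ms" and ?q = "F.expansions base ns" and ?w = "F.expand_all base ns"
  have p: "edge_path F.SC base ?p ?w" and q: "edge_path F.SC base ?q ?w"
    using F.edge_path_expansions f(1-3) by metis+
  have r: "edge_path F.SC ?w (rev_path F.SC ?q) base" by (rule F.edge_path_rev_path[OF q])
  obtain i j n i' j' n' where "?w = word i (i + j + n) j" "val base ?w ?p = potential i j n"
      "?w = word i' (i' + j' + n') j'" "val base ?w ?q = potential i' j' n'"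
    using val_positive[OF f(1)] val_positive[OF f(2)] unfolding f(3) by metis
  moreover from this have "i' = i" "j' = j" "n' = n" by auto
  ultimately have eq: "val base ?w ?p = val base ?w ?q" by simp
  have "val base base es = val base base (?p @ rev_path F.SC ?q)"
    by (rule val_homotopic[OF reachable_base f(4)])
  also have "\<dots> = val base ?w ?q \<otimes> val ?w base (rev_path F.SC ?q)"
    by (simp add: val_append[OF reachable_base p r] eq)
  also have "\<dots> = val base base (?q @ rev_path F.SC ?q)"
    by (rule val_append[OF reachable_base q r, symmetric])
  also have "\<dots> = val base base []"
    by (rule val_homotopic[OF reachable_base F.homotopic_paths_rev_path[OF q]])
  also have "\<dots> = \<one>"
    using val_loop[of "[]"] base \<pi>.hom_one by (simp add: edge_path_Nil one_fundamental_group)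
  finally show ?thesis by (simp add: val_loop[OF assms])
qed

end

theorem simple_diagram_group_perfect: "is_perfect_group simple_diagram_group"
proof -
  interpret G: group simple_diagram_group by (rule group_simple_diagram_group)
  let ?D = "derived simple_diagram_group (carrier simple_diagram_group)"
  have D: "?D \<lhd> simple_diagram_group" by (rule G.derived_self_is_normal)
  interpret A: comm_group "simple_diagram_group Mod ?D" by (rule G.derived_quot_is_comm_group)
  have "(\<lambda>x. ?D #>\<^bsub>simple_diagram_group\<^esub> x) \<in> hom simple_diagram_group (simple_diagram_group Mod ?D)"
    using normal.r_coset_hom_Mod[OF D] .
  then interpret H: group_hom "fundamental_group F.SC base" "simple_diagram_group Mod ?D" "\<lambda>x. ?D #>\<^bsub>simple_diagram_group\<^esub> x"
    unfolding simple_diagram_group_def[symmetric]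
    by (intro group_hom.intro group_hom_axioms.intro group_simple_diagram_group A.is_group)
  interpret E: simple_diagram_group_abelian_image "simple_diagram_group Mod ?D" "\<lambda>x. ?D #>\<^bsub>simple_diagram_group\<^esub> x"
    by unfold_locales (simp add: F.verts_SC)
  have "?D #>\<^bsub>simple_diagram_group\<^esub> x = ?D" if x: "x \<in> carrier simple_diagram_group" for x
  proof -
    obtain es where "edge_path F.SC base es base" "x = F.path_class base es"
      using x by (rule simple_diagram_group_cases)
    then show ?thesis using E.trivial_on_loops by (simp add: FactGroup_def)
  qed
  then show ?thesis
    using G.derived_eq_carrierI group_simple_diagram_group by (simp add: is_perfect_group_def)
qed

theorem simple_diagram_group_is_simple: "is_simple_group simple_diagram_group"
proof -
  have "N = {\<one>\<^bsub>simple_diagram_group\<^esub>} \<or> N = carrier simple_diagram_group" if N: "N \<lhd> simple_diagram_group" for N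
  proof (cases "N = {\<one>\<^bsub>simple_diagram_group\<^esub>}")
    case False
    have "carrier simple_diagram_group \<subseteq> N"
      using derived_simple_diagram_group_subset_normal[OF N False] simple_diagram_group_perfect by (simp add: is_perfect_group_def)
    moreover have "N \<subseteq> carrier simple_diagram_group"
      using N by (simp add: normal_def subgroup.subset)
    ultimately show ?thesis by blast
  qed simp
  then show ?thesis
    using group_simple_diagram_group simple_diagram_group_nontrivial by (simp add: is_simple_group_def)
qed

lemma simple_diagram_group_is_diagram_group: "is_diagram_group TYPE(nat) simple_diagram_group"
proof -
  have "base \<in> lists (alphabet F.presentation) - {[]}" by (simp add: F.presentation_def)
  then show ?thesis
    unfolding is_diagram_group_def using group_simple_diagram_group F.semigroup_presentation iso_refl by blast
qed

theorem corollary27: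
  shows "(\<exists>G :: nat squier_edge list set monoid. is_diagram_group TYPE(nat) G \<and> is_simple_group G)
    \<and> (\<exists>G :: nat squier_edge list set monoid. is_diagram_group TYPE(nat) G
          \<and> carrier G \<noteq> {\<one>\<^bsub>G\<^esub>} \<and> is_perfect_group G
          \<and> \<not> admits_LOG_presentation TYPE('x) G)
    \<and> (\<forall>H :: ('g, 'm) monoid_scheme. is_diagram_group TYPE('s) H
          \<and> carrier H \<noteq> {\<one>\<^bsub>H\<^esub>} \<and> is_perfect_group H
          \<longrightarrow> \<not> admits_LOG_presentation TYPE('x) H)"
proof (intro conjI allI impI)
  show "\<exists>G :: nat squier_edge list set monoid. is_diagram_group TYPE(nat) G \<and> is_simple_group G"
    using simple_diagram_group_is_diagram_group simple_diagram_group_is_simple by blast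
  show "\<exists>G :: nat squier_edge list set monoid. is_diagram_group TYPE(nat) G
      \<and> carrier G \<noteq> {\<one>\<^bsub>G\<^esub>} \<and> is_perfect_group G \<and> \<not> admits_LOG_presentation TYPE('x) G"
    using simple_diagram_group_is_diagram_group simple_diagram_group_nontrivial simple_diagram_group_perfect
      perfect_group_no_LOG_presentation[OF simple_diagram_group_perfect simple_diagram_group_nontrivial]
    by (intro exI[of _ simple_diagram_group] conjI)
  fix H :: "('g, 'm) monoid_scheme"
  assume "is_diagram_group TYPE('s) H \<and> carrier H \<noteq> {\<one>\<^bsub>H\<^esub>} \<and> is_perfect_group H"
  then show "\<not> admits_LOG_presentation TYPE('x) H"
    by (elim conjE) (rule perfect_group_no_LOG_presentation)
qed

end
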